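(* Let $\mathcal G$ be a moral DAG with skeleton $G=(V,E)$, a finite graph. 1) If $r>0$, $x\in M_G$ and $N\sim\operatorname{nm}_G(r,x)$, then $$\mathbb P(N=n)=\prod_{i\in V}\operatorname{nb}(r+|n_{\mathfrak{pa}(i)}|,u_i^{\mathcal G})(n_i),\qquad n\in\mathbb N^V,$$ where $u_i^{\mathcal G}=1-\dfrac{\Delta_{\overline{\mathfrak{de}}(i)}(x)}{\Delta_{\mathfrak{de}(i)}(x)}$ and $\operatorname{nb}(s,p)(k)=\frac{\Gamma(s+k)}{\Gamma(s)\,k!}p^k(1-p)^s$, $k\in\mathbb N$, for $s>0$, $p\in(0,1)$. In particular, for every $i\in V$, $$\mathbb P(N_i=n_i\mid N_{\mathfrak{pa}(i)}=n_{\mathfrak{pa}(i)})=\operatorname{nb}(r+|n_{\mathfrak{pa}(i)}|,u_i^{\mathcal G})(n_i).$$ 2) If $r\in\{1,2,\ldots\}$, $y\in(0,\infty)^V$ and $N\sim\operatorname{mult}_G(r,y)$, then $$\mathbb P(N=n)=\prod_{i\in V}\operatorname{bin}(r-|n_{\mathfrak{pa}(i)}|,w_i^{\mathcal G})(n_i),\qquad n\in\mathbb N_{G,r},$$ where $w_i^{\mathcal G}=\dfrac{\delta_{\overline{\mathfrak{de}}(i)}(y)}{\delta_{\mathfrak{de}(i)}(y)}-1$ and $\operatorname{bin}(s,w)(k)=\binom{s}{k}w^k(1+w)^{-s}$, $k\in\{0,\ldots,s\}$, for $s\in\mathbb N$, $w>0$ (the binomial distribution with $s$ trials and success probability $w/(1+w)$).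 In particular, for every $i\in V$ (and every $n_{\mathfrak{pa}(i)}$ such that the conditioning event has positive probability), $$\mathbb P(N_i=n_i\mid N_{\mathfrak{pa}(i)}=n_{\mathfrak{pa}(i)})=\operatorname{bin}(r-|n_{\mathfrak{pa}(i)}|,w_i^{\mathcal G})(n_i).$$
   Context: $\mathbb N=\{0,1,2,\ldots\}$. $G=(V,E)$ is a finite undirected simple graph; $G^*$ is its complement graph; $G_A$ is the subgraph induced by $A\subset V$. A clique is a set of pairwise adjacent vertices ($\emptyset$ and singletons are cliques); $\mathcal C_G$ is the set of cliques and $\mathcal C_G^+$ the set of maximal cliques of $G$. A moral DAG $\mathcal G$ with skeleton $G$ is an orientation of all edges of $G$ without directed cycles such that any two distinct parents of a common vertex are adjacent (then $G$ is decomposable, i.e. chordal). $\mathfrak{pa}(i)=\{j:j\to i\}$ denotes the parents of $i$, $\mathfrak{de}(i)$ the set of descendants of $i$ (vertices reachable from $i$ by a directed path of length at least 1), $\overline{\mathfrak{de}}(i)=\mathfrak{de}(i)\cup\{i\}$. Polynomials: $\Delta_G(x)=\sum_{C\in\mathcal C_{G^*}}(-1)^{|C|}\prod_{i\in C}x_i$, $\delta_G(y)=\sum_{C\in\mathcal C_{G^*}}\prod_{i\in C}y_i$; for $A\subset V$, $\Delta_A(x):=\Delta_{G_A}(x_A)$, $\delta_A(y):=\delta_{G_A}(y_A)$, $\Delta_\emptyset=\delta_\emptyset=1$. $M_G=\{x\in(0,\infty)^V:\Delta_A(x)>0\ \forall A\subset V\}$. Notation: $x_A=(x_i)_{i\in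 A}$, $x^n=\prod_{i\in V}x_i^{n_i}$, $|n_A|=\sum_{i\in A}n_i$, $|n|=|n_V|$. For an integer $r\ge1$, $\binom{r}{n}_G$ is defined by $\delta_G(y)^r=\sum_{n\in\mathbb N^V}\binom{r}{n}_G y^n$; for real $r>0$, $\genfrac{[}{]}{0pt}{}{|n|+r-1}{n}_G$ is defined by the formal power series $\Delta_G(x)^{-r}=\sum_{n\in\mathbb N^V}\genfrac{[}{]}{0pt}{}{|n|+r-1}{n}_G x^n$. $N\sim\operatorname{nm}_G(r,x)$ ($r>0$, $x\in M_G$) means $\mathbb P(N=n)=\genfrac{[}{]}{0pt}{}{|n|+r-1}{n}_G\,x^n\Delta_G(x)^r$, $n\in\mathbb N^V$. $N\sim\operatorname{mult}_G(r,y)$ ($r\in\{1,2,\ldots\}$, $y\in(0,\infty)^V$) means $\mathbb P(N=n)=\binom{r}{n}_G\,y^n\delta_G(y)^{-r}$, $n\in\mathbb N_{G,r}:=\{n\in\mathbb N^V:\max_{C\in\mathcal C_G^+}|n_C|\le r\}$. *)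

theory Defs
  imports
    "HOL-Probability.Probability"
    "HOL-Library.Poly_Mapping"
    "HOL-Library.Ramsey"
begin

section \<open>Graphs\<close>

text \<open>
  A graph is given by its vertex set and its set of edges, the edges being two-element subsets of
  the vertex set; \<^const>\<open>clique\<close> is the notion from the library (with the empty set and the
  singletons as cliques).
\<close>

definition finite_simple_graph :: "'v set \<Rightarrow> 'v set set \<Rightarrow> bool" where
  "finite_simple_graph V E \<longleftrightarrow> finite V \<and> E \<subseteq> nsets V 2"

definition complement_edges :: "'v set \<Rightarrow> 'v set set \<Rightarrow> 'v set set" where
  "complement_edges V E = nsets V 2 - E"

definition induced_edges :: "'v set set \<Rightarrow> 'v set \<Rightarrow> 'v set set" where
  "induced_edges E A = {e \<in> E. e \<subseteq> A}"

definition cliques :: "'v set \<Rightarrow> 'v set set \<Rightarrow> 'v set set" where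
  "cliques V E = {C. C \<subseteq> V \<and> clique C E}"

definition maximal_cliques :: "'v set \<Rightarrow> 'v set set \<Rightarrow> 'v set set" where
  "maximal_cliques V E = {C \<in> cliques V E. \<forall>C' \<in> cliques V E. C \<subseteq> C' \<longrightarrow> C' = C}"


section \<open>Moral directed acyclic graphs\<close>

text \<open>A directed graph is the relation consisting of the pairs \<open>(i, j)\<close> with \<open>i \<rightarrow> j\<close>.\<close>

definition parents :: "('v \<times> 'v) set \<Rightarrow> 'v \<Rightarrow> 'v set" where
  "parents D i = {j. (j, i) \<in> D}"

definition descendants :: "('v \<times> 'v) set \<Rightarrow> 'v \<Rightarrow> 'v set" where
  "descendants D i = {j. (i, j) \<in> D\<^sup>+}"

definition descendants_refl :: "('v \<times> 'v) set \<Rightarrow> 'v \<Rightarrow> 'v set" where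
  "descendants_refl D i = insert i (descendants D i)"

text \<open>
  Acyclicity excludes that an edge is oriented both ways.
\<close>

definition moral_DAG :: "'v set \<Rightarrow> 'v set set \<Rightarrow> ('v \<times> 'v) set \<Rightarrow> bool" where
  "moral_DAG V E D \<longleftrightarrow>
     D \<subseteq> V \<times> V \<and>
     (\<forall>i j. {i, j} \<in> E \<longleftrightarrow> (i, j) \<in> D \<or> (j, i) \<in> D) \<and>
     acyclic D \<and>
     (\<forall>k. \<forall>i \<in> parents D k. \<forall>j \<in> parents D k. i \<noteq> j \<longrightarrow> {i, j} \<in> E)"


section \<open>The graph polynomials\<close>

text \<open>
  Both polynomials are defined as functions of elements of an arbitrary commutative (semi)ring.
  Substituting real numbers gives the polynomial functions; substituting the indeterminates
  \<open>indet i\<close> of the library's ring of multivariate polynomials gives the formal polynomials.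
\<close>

definition Delta :: "'v set \<Rightarrow> 'v set set \<Rightarrow> ('v \<Rightarrow> 'a::comm_ring_1) \<Rightarrow> 'a" where
  "Delta V E x = (\<Sum>C \<in> cliques V (complement_edges V E). (-1) ^ card C * (\<Prod>i\<in>C. x i))"

definition delta :: "'v set \<Rightarrow> 'v set set \<Rightarrow> ('v \<Rightarrow> 'a::comm_semiring_1) \<Rightarrow> 'a" where
  "delta V E y = (\<Sum>C \<in> cliques V (complement_edges V E). \<Prod>i\<in>C. y i)"

definition Delta_sub :: "'v set set \<Rightarrow> 'v set \<Rightarrow> ('v \<Rightarrow> real) \<Rightarrow> real" where
  "Delta_sub E A x = Delta A (induced_edges E A) x"

definition delta_sub :: "'v set set \<Rightarrow> 'v set \<Rightarrow> ('v \<Rightarrow> real) \<Rightarrow> real" where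
  "delta_sub E A y = delta A (induced_edges E A) y"

text \<open>Points of \<open>\<real>\<^sup>V\<close> are functions on the type of vertices whose values outside \<open>V\<close> are irrelevant.\<close>

definition M_set :: "'v set \<Rightarrow> 'v set set \<Rightarrow> ('v \<Rightarrow> real) set" where
  "M_set V E = {x. (\<forall>i\<in>V. 0 < x i) \<and> (\<forall>A. A \<subseteq> V \<longrightarrow> 0 < Delta_sub E A x)}"


section \<open>Multi-indices and coefficients\<close>

text \<open>
  The elements of \<open>\<nat>\<^sup>V\<close> are the finitely supported functions with support in \<open>V\<close>, so that they are
  also the exponents of the monomials of \<^typ>\<open>('v \<Rightarrow>\<^sub>0 nat) \<Rightarrow>\<^sub>0 real\<close>.
\<close>

definition multi_indices :: "'v set \<Rightarrow> ('v \<Rightarrow>\<^sub>0 nat) set" where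
  "multi_indices V = {n. Poly_Mapping.keys n \<subseteq> V}"

definition weight :: "'v set \<Rightarrow> ('v \<Rightarrow>\<^sub>0 nat) \<Rightarrow> nat" where
  "weight A n = (\<Sum>i\<in>A. Poly_Mapping.lookup n i)"

definition multi_power :: "'v set \<Rightarrow> ('v \<Rightarrow> real) \<Rightarrow> ('v \<Rightarrow>\<^sub>0 nat) \<Rightarrow> real" where
  "multi_power V x n = (\<Prod>i\<in>V. x i ^ Poly_Mapping.lookup n i)"

definition bounded_multi_indices :: "'v set \<Rightarrow> 'v set set \<Rightarrow> nat \<Rightarrow> ('v \<Rightarrow>\<^sub>0 nat) set" where
  "bounded_multi_indices V E r =
     {n \<in> multi_indices V. Max ((\<lambda>C. weight C n) ` maximal_cliques V E) \<le> r}"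

definition indet :: "'v \<Rightarrow> ('v \<Rightarrow>\<^sub>0 nat) \<Rightarrow>\<^sub>0 real" where
  "indet i = Poly_Mapping.single (Poly_Mapping.single i 1) 1"

definition mult_coeff :: "'v set \<Rightarrow> 'v set set \<Rightarrow> nat \<Rightarrow> ('v \<Rightarrow>\<^sub>0 nat) \<Rightarrow> real" where
  "mult_coeff V E r n = Poly_Mapping.lookup (delta V E indet ^ r) n"

text \<open>
  The coefficient of \<open>x\<^sup>n\<close> in the formal power series \<open>\<Delta>(x)\<close> to the power \<open>-r\<close>. A real power \<open>a\<close> of a
  power series \<open>F\<close> with constant term \<open>1\<close> is given by the binomial series
  \<open>\<Sum>k. (a gchoose k) * (F - 1) ^ k\<close>. As the constant term of \<open>F - 1\<close> vanishes, only the summands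
  with \<open>k \<le> |n|\<close> contribute to the coefficient of \<open>x\<^sup>n\<close>; see lemma \<open>lookup_Delta_power_eq_0\<close> below.
\<close>

definition nm_coeff :: "'v set \<Rightarrow> 'v set set \<Rightarrow> real \<Rightarrow> ('v \<Rightarrow>\<^sub>0 nat) \<Rightarrow> real" where
  "nm_coeff V E r n = (\<Sum>k\<le>weight V n. ((- r) gchoose k) * Poly_Mapping.lookup ((Delta V E indet - 1) ^ k) n)"

lemma weight_add: "weight A (m + n) = weight A m + weight A n"
  by (simp add: weight_def lookup_add sum.distrib)

lemma prod_indet:
  "finite C \<Longrightarrow> (\<Prod>i\<in>C. indet i) = Poly_Mapping.single (\<Sum>i\<in>C. Poly_Mapping.single i 1) (1::real)"
  by (induction C rule: finite_induct) (auto simp: indet_def mult_single)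

lemma Delta_indet_minus_1:
  fixes V :: "'v set"
  assumes "finite V"
  shows "Delta V E indet - 1 =
    (\<Sum>C \<in> cliques V (complement_edges V E) - {{}}. (-1) ^ card C * (\<Prod>i\<in>C. indet i))"
proof -
  have "finite (cliques V (complement_edges V E))"
    using assms by (auto simp: cliques_def intro: finite_subset[of _ "Pow V"])
  moreover have "{} \<in> cliques V (complement_edges V E)"
    by (auto simp: cliques_def clique_def)
  ultimately show ?thesis
    unfolding Delta_def by (simp add: sum.remove[of _ "{}"])
qed

lemma lookup_Delta_minus_1_eq_0:
  fixes V :: "'v set"
  assumes "finite V" "weight V n = 0"
  shows "Poly_Mapping.lookup (Delta V E indet - 1) n = 0"
proof -
  have "Poly_Mapping.lookup ((-1) ^ card C * (\<Prod>i\<in>C. indet i)) n = 0"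
    if C: "C \<in> cliques V (complement_edges V E) - {{}}" for C
  proof -
    from C have sub: "C \<subseteq> V" "C \<noteq> {}" "finite C"
      using assms(1) by (auto simp: cliques_def intro: finite_subset)
    then obtain j where j: "j \<in> C" by blast
    have "Poly_Mapping.lookup (\<Sum>i\<in>C. Poly_Mapping.single i (1::nat)) j \<noteq> Poly_Mapping.lookup n j"
      using assms j sub by (auto simp: weight_def lookup_sum lookup_single when_def)
    then have "(\<Sum>i\<in>C. Poly_Mapping.single i (1::nat)) \<noteq> n"
      by blast
    then have "Poly_Mapping.lookup (\<Prod>i\<in>C. indet i) n = 0"
      using sub by (simp add: prod_indet lookup_single)
    then show ?thesis
      by (cases "even (card C)") simp_all
  qed
  then show ?thesis
    using assms(1) by (simp add: Delta_indet_minus_1 lookup_sum)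
qed

lemma lookup_Delta_power_eq_0:
  fixes V :: "'v set"
  assumes "finite V" "weight V n < k"
  shows "Poly_Mapping.lookup ((Delta V E indet - 1) ^ k) n = 0"
  using assms(2)
proof (induction k arbitrary: n)
  case (Suc k)
  show ?case
  proof (rule ccontr)
    assume "Poly_Mapping.lookup ((Delta V E indet - 1) ^ Suc k) n \<noteq> 0"
    then have "n \<in> Poly_Mapping.keys ((Delta V E indet - 1) * (Delta V E indet - 1) ^ k)"
      by (simp add: in_keys_iff)
    then obtain a b where ab: "n = a + b" "a \<in> Poly_Mapping.keys (Delta V E indet - 1 :: ('v \<Rightarrow>\<^sub>0 nat) \<Rightarrow>\<^sub>0 real)"
        "b \<in> Poly_Mapping.keys ((Delta V E indet - 1 :: ('v \<Rightarrow>\<^sub>0 nat) \<Rightarrow>\<^sub>0 real) ^ k)"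
      using keys_mult by blast
    have "weight V a > 0"
      using ab(2) lookup_Delta_minus_1_eq_0[OF assms(1), of a E] by (auto simp: in_keys_iff)
    moreover have "weight V b \<ge> k"
      using ab(3) Suc.IH[of b] by (auto simp: in_keys_iff not_less[symmetric])
    ultimately show False
      using Suc.prems ab(1) by (simp add: weight_add)
  qed
qed simp


section \<open>The distributions\<close>

text \<open>
  \<open>N\<close> is an \<open>\<nat>\<^sup>V\<close>-valued random variable on the probability space \<open>M\<close>, measurable for the discrete
  sigma-algebra.
\<close>

definition nm_distributed ::
  "'b measure \<Rightarrow> ('b \<Rightarrow> 'v \<Rightarrow>\<^sub>0 nat) \<Rightarrow> 'v set \<Rightarrow> 'v set set \<Rightarrow> real \<Rightarrow> ('v \<Rightarrow> real) \<Rightarrow> bool" where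
  "nm_distributed M N V E r x \<longleftrightarrow>
     N \<in> M \<rightarrow>\<^sub>M count_space (multi_indices V) \<and>
     (\<forall>n \<in> multi_indices V.
        \<P>(\<omega> in M. N \<omega> = n) = nm_coeff V E r n * multi_power V x n * Delta V E x powr r)"

definition mult_distributed ::
  "'b measure \<Rightarrow> ('b \<Rightarrow> 'v \<Rightarrow>\<^sub>0 nat) \<Rightarrow> 'v set \<Rightarrow> 'v set set \<Rightarrow> nat \<Rightarrow> ('v \<Rightarrow> real) \<Rightarrow> bool" where
  "mult_distributed M N V E r y \<longleftrightarrow>
     N \<in> M \<rightarrow>\<^sub>M count_space (multi_indices V) \<and>
     (\<forall>n \<in> bounded_multi_indices V E r.
        \<P>(\<omega> in M. N \<omega> = n) = mult_coeff V E r n * multi_power V y n / delta V E y ^ r)"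

definition nb :: "real \<Rightarrow> real \<Rightarrow> nat \<Rightarrow> real" where
  "nb s p k = Gamma (s + real k) / (Gamma s * fact k) * p ^ k * (1 - p) powr s"

definition bin :: "nat \<Rightarrow> real \<Rightarrow> nat \<Rightarrow> real" where
  "bin s w k = real (s choose k) * w ^ k / (1 + w) ^ s"

definition u_param :: "'v set set \<Rightarrow> ('v \<times> 'v) set \<Rightarrow> ('v \<Rightarrow> real) \<Rightarrow> 'v \<Rightarrow> real" where
  "u_param E D x i = 1 - Delta_sub E (descendants_refl D i) x / Delta_sub E (descendants D i) x"

definition w_param :: "'v set set \<Rightarrow> ('v \<times> 'v) set \<Rightarrow> ('v \<Rightarrow> real) \<Rightarrow> 'v \<Rightarrow> real" where
  "w_param E D y i = delta_sub E (descendants_refl D i) y / delta_sub E (descendants D i) y - 1"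

end

theory Submission
  imports Defs
begin

text \<open>
  A clique of the complement graph is a stable set, so \<open>\<delta>\<close> is the independence polynomial of the graph
  and \<open>\<Delta>(x) = \<delta>(-x)\<close>. Everything is therefore derived for \<open>\<delta>\<close>, at points whose coordinates may have
  any sign.

  Both sides of the product formula consist of a coefficient that depends only on \<open>n\<close> and \<open>r\<close>, and of
  powers of numbers that depend on the point \<open>x\<close> or \<open>y\<close>. The coefficients and the powers agree separately.

  \<^item> The coefficients. Expanding \<open>\<delta>\<^sup>r\<close> shows that the coefficient of \<open>y\<^sup>n\<close> counts the multicolourings in
    which the vertex \<open>i\<close> receives a set of \<open>n\<^sub>i\<close> of the \<open>r\<close> colours and adjacent vertices receive disjoint
    sets. Colouring the vertices along the directed graph, the parents of \<open>i\<close> form a clique and have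
    used up exactly \<open>|n\<^bsub>pa(i)\<^esub>|\<close> colours when \<open>i\<close> is reached, which leaves
    \<open>(r - |n\<^bsub>pa(i)\<^esub>|) choose n\<^sub>i\<close> possibilities (\<open>colouring_count_eq_prod\<close>). For fixed \<open>n\<close>, the
    coefficient of \<open>x\<^sup>n\<close> in \<open>\<Delta>\<^bsup>-r\<^esup>\<close> is a polynomial in \<open>r\<close>, and at \<open>r = -m\<close> it is the coefficient in
    \<open>\<Delta>\<^sup>m\<close>, which is known up to sign from the multicolourings; hence it is the product of the
    coefficients of the negative binomial laws for all real \<open>r\<close> (\<open>nm_coeff_eq_prod\<close>).

  \<^item> The monomial and the normalization. Put \<open>q\<^sub>i = \<delta>\<^bsub>de(i) \<union> {i}\<^esub> / \<delta>\<^bsub>de(i)\<^esub>\<close>. In a set of vertices closed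
    under descendants, a vertex \<open>s\<close> without parents there is, together with its descendants, separated
    from all the other vertices, so that removing \<open>s\<close> divides the polynomial of the set by \<open>q\<^sub>s\<close>.
    Removing vertices one after the other gives \<open>\<delta>\<^sub>V = \<Prod>\<^sub>i q\<^sub>i\<close> and \<open>y\<^sub>i = (q\<^sub>i - 1) \<Prod>\<^bsub>j child of i\<^esub> q\<^sub>j\<close>. So
    \<open>y\<^sup>n\<close> is a product over \<open>i\<close> in which \<open>q\<^sub>i - 1\<close> has the exponent \<open>n\<^sub>i\<close> and \<open>q\<^sub>i\<close> the exponent \<open>|n\<^bsub>pa(i)\<^esub>|\<close>
    (\<open>monomial_eq_prod_ratio\<close>). Finally \<open>w\<^sub>i = q\<^sub>i - 1\<close>, and \<open>u\<^sub>i = 1 - q\<^sub>i\<close> when \<open>q\<^sub>i\<close> is taken at \<open>-x\<close>.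

  The conditional laws follow from the product formula alone: each factor sums to \<open>1\<close> over \<open>n\<^sub>i\<close>, so the
  vertices outside an ancestral set can be summed out, and what remains for \<open>i\<close> and its
  non-descendants is the law of the non-descendants times the factor of \<open>i\<close>, which depends on them only
  through the parents. In the multinomial case the law is prescribed only on the bounded
  multi-indices; it vanishes elsewhere because the prescribed weights already add up to \<open>1\<close>.
\<close>


section \<open>Independence polynomials\<close>

definition stable_sets :: "'v set set \<Rightarrow> 'v set \<Rightarrow> 'v set set" where
  "stable_sets E A = {C. C \<subseteq> A \<and> (\<forall>i\<in>C. \<forall>j\<in>C. i \<noteq> j \<longrightarrow> {i, j} \<notin> E)}"

lemma finite_stable_sets: "finite A \<Longrightarrow> finite (stable_sets E A)"
  by (rule finite_subset[of _ "Pow A"]) (auto simp: stable_sets_def)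

lemma finite_stable_set: "finite A \<Longrightarrow> C \<in> stable_sets E A \<Longrightarrow> finite C"
  by (auto simp: stable_sets_def intro: finite_subset)

lemma cliques_complement_edges: "cliques A (complement_edges A E) = stable_sets E A"
  unfolding cliques_def clique_def stable_sets_def complement_edges_def
  by (auto dest: subsetD)

lemma stable_sets_induced_edges: "stable_sets (induced_edges E A) A = stable_sets E A"
  unfolding stable_sets_def induced_edges_def by blast

lemma delta_eq_sum_stable_sets: "delta A E y = (\<Sum>C\<in>stable_sets E A. \<Prod>i\<in>C. y i)"
  by (simp add: delta_def cliques_complement_edges)

lemma delta_sub_eq_sum_stable_sets: "delta_sub E A y = (\<Sum>C\<in>stable_sets E A. \<Prod>i\<in>C. y i)"
  by (simp add: delta_sub_def delta_eq_sum_stable_sets stable_sets_induced_edges)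

lemma delta_sub_eq_delta: "delta_sub E A y = delta A E y"
  by (simp add: delta_sub_eq_sum_stable_sets delta_eq_sum_stable_sets)

lemma Delta_eq_delta: "Delta A E x = delta A E (\<lambda>i. - x i)"
  by (simp add: Delta_def delta_def prod_uminus)

lemma Delta_sub_eq_delta_sub: "Delta_sub E A x = delta_sub E A (\<lambda>i. - x i)"
  by (simp add: Delta_sub_def Delta_eq_delta delta_sub_def)

lemma delta_sub_pos:
  assumes "finite A" "\<And>i. i \<in> A \<Longrightarrow> 0 < y i"
  shows "0 < delta_sub E A y"
  unfolding delta_sub_eq_sum_stable_sets
proof (rule sum_pos)
  show "finite (stable_sets E A)"
    using assms(1) by (rule finite_stable_sets)
  show "stable_sets E A \<noteq> {}"
    by (auto simp: stable_sets_def)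
  show "0 < (\<Prod>i\<in>C. y i)" if "C \<in> stable_sets E A" for C
    using that assms(2) by (intro prod_pos) (auto simp: stable_sets_def)
qed

text \<open>
  A stable set either avoids \<open>v\<close> or is \<open>v\<close> together with a stable set of non-neighbours of \<open>v\<close>.
\<close>

lemma delta_sub_remove:
  assumes "finite A" "v \<in> A"
  shows "delta_sub E A y =
    delta_sub E (A - {v}) y + y v * delta_sub E {i \<in> A - {v}. {v, i} \<notin> E} y"
proof -
  let ?B = "{i \<in> A - {v}. {v, i} \<notin> E}"
  have split: "stable_sets E A = stable_sets E (A - {v}) \<union> insert v ` stable_sets E ?B"
  proof (intro equalityI subsetI)
    fix C assume C: "C \<in> stable_sets E A"
    show "C \<in> stable_sets E (A - {v}) \<union> insert v ` stable_sets E ?B"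
    proof (cases "v \<in> C")
      case True
      then have "C = insert v (C - {v})" "C - {v} \<in> stable_sets E ?B"
        using C by (auto simp: stable_sets_def)
      then show ?thesis by blast
    next
      case False
      then show ?thesis using C by (auto simp: stable_sets_def)
    qed
  next
    fix C assume "C \<in> stable_sets E (A - {v}) \<union> insert v ` stable_sets E ?B"
    then show "C \<in> stable_sets E A"
      using assms(2) by (auto simp: stable_sets_def insert_commute)
  qed
  have inj: "inj_on (insert v) (stable_sets E ?B)"
    by (rule inj_onI) (auto simp: stable_sets_def)
  have prod: "(\<Prod>i\<in>insert v C. y i) = y v * (\<Prod>i\<in>C. y i)" if "C \<in> stable_sets E ?B" for C
  proof -
    have "v \<notin> C" using that by (auto simp: stable_sets_def)
    moreover have "finite C" using that assms(1) by (auto intro: finite_stable_set[of ?B])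
    ultimately show ?thesis by simp
  qed
  have "delta_sub E A y = (\<Sum>C\<in>stable_sets E (A - {v}). \<Prod>i\<in>C. y i)
      + (\<Sum>C\<in>insert v ` stable_sets E ?B. \<Prod>i\<in>C. y i)"
    unfolding delta_sub_eq_sum_stable_sets split
    by (rule sum.union_disjoint) (use assms(1) in \<open>auto simp: finite_stable_sets\<close>,
        auto simp: stable_sets_def)
  also have "(\<Sum>C\<in>insert v ` stable_sets E ?B. \<Prod>i\<in>C. y i) = y v * delta_sub E ?B y"
    unfolding sum.reindex[OF inj] delta_sub_eq_sum_stable_sets sum_distrib_left
    by (rule sum.cong) (simp_all only: o_apply prod)
  finally show ?thesis
    by (simp add: delta_sub_eq_sum_stable_sets)
qed

lemma delta_sub_disconnected:
  assumes "finite A" "finite B" "A \<inter> B = {}" "\<And>i j. i \<in> A \<Longrightarrow> j \<in> B \<Longrightarrow> {i, j} \<notin> E"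
  shows "delta_sub E (A \<union> B) y = delta_sub E A y * delta_sub E B y"
proof -
  have "delta_sub E A y * delta_sub E B y =
      (\<Sum>(S, T)\<in>stable_sets E A \<times> stable_sets E B. \<Prod>i\<in>S \<union> T. y i)"
  proof -
    have "(\<Prod>i\<in>S \<union> T. y i) = (\<Prod>i\<in>S. y i) * (\<Prod>i\<in>T. y i)"
      if "S \<in> stable_sets E A" "T \<in> stable_sets E B" for S T
      using that assms(1,2,3)
      by (intro prod.union_disjoint) (auto intro: finite_stable_set, auto simp: stable_sets_def)
    then show ?thesis
      unfolding delta_sub_eq_sum_stable_sets sum_product sum.cartesian_product
      by (intro sum.cong) auto
  qed
  also have "\<dots> = (\<Sum>C\<in>stable_sets E (A \<union> B). \<Prod>i\<in>C. y i)"
  proof (rule sum.reindex_bij_witness[where i = "\<lambda>C. (C \<inter> A, C \<inter> B)" and j = "\<lambda>(S, T). S \<union> T"])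
    fix p assume "p \<in> stable_sets E A \<times> stable_sets E B"
    then obtain S T where p: "p = (S, T)" "S \<in> stable_sets E A" "T \<in> stable_sets E B"
      by blast
    have ST: "{i, j} \<notin> E" "{j, i} \<notin> E" if "i \<in> S" "j \<in> T" for i j
    proof -
      have "i \<in> A" "j \<in> B"
        using that p by (auto simp: stable_sets_def)
      then show "{i, j} \<notin> E" "{j, i} \<notin> E"
        using assms(4) by (simp_all add: insert_commute)
    qed
    show "(case p of (S, T) \<Rightarrow> S \<union> T) \<in> stable_sets E (A \<union> B)"
      using p ST by (auto simp: stable_sets_def)
    show "((case p of (S, T) \<Rightarrow> S \<union> T) \<inter> A, (case p of (S, T) \<Rightarrow> S \<union> T) \<inter> B) = p"
      using p assms(3) by (auto simp: stable_sets_def)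
  next
    fix C assume "C \<in> stable_sets E (A \<union> B)"
    then show "(C \<inter> A, C \<inter> B) \<in> stable_sets E A \<times> stable_sets E B"
      "(case (C \<inter> A, C \<inter> B) of (S, T) \<Rightarrow> S \<union> T) = C"
      by (auto simp: stable_sets_def)
  qed auto
  finally show ?thesis
    by (simp add: delta_sub_eq_sum_stable_sets)
qed


section \<open>Moral directed acyclic graphs\<close>

locale moral_DAG_graph =
  fixes V :: "'v set" and E :: "'v set set" and D :: "('v \<times> 'v) set"
  assumes simple: "finite_simple_graph V E"
    and moral_DAG: "moral_DAG V E D"
begin

lemma finite_V: "finite V"
  using simple by (simp add: finite_simple_graph_def)

lemma arcs_in_V: "D \<subseteq> V \<times> V"
  using moral_DAG by (simp add: moral_DAG_def)

lemma finite_D: "finite D"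
  using arcs_in_V finite_V by (meson finite_SigmaI finite_subset)

lemma acyclic: "acyclic D"
  using moral_DAG by (simp add: moral_DAG_def)

lemma edge_iff: "{i, j} \<in> E \<longleftrightarrow> (i, j) \<in> D \<or> (j, i) \<in> D"
  using moral_DAG by (simp add: moral_DAG_def)

lemma parents_adjacent: "(i, k) \<in> D \<Longrightarrow> (j, k) \<in> D \<Longrightarrow> i \<noteq> j \<Longrightarrow> (i, j) \<in> D \<or> (j, i) \<in> D"
  using moral_DAG edge_iff by (auto simp: moral_DAG_def parents_def)

lemma no_directed_cycle: "(i, i) \<notin> D\<^sup>+"
  using acyclic by (simp add: acyclic_def)

lemma no_loop: "(i, i) \<notin> D"
  using no_directed_cycle by blast

lemma arc_in_V: "(i, j) \<in> D \<Longrightarrow> i \<in> V \<and> j \<in> V"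
  using arcs_in_V by blast

lemma path_in_V: "(i, j) \<in> D\<^sup>+ \<Longrightarrow> i \<in> V \<and> j \<in> V"
  using arcs_in_V trancl_subset_Sigma by blast

lemma parents_subset: "parents D i \<subseteq> V"
  using arc_in_V by (auto simp: parents_def)

lemma finite_parents: "finite (parents D i)"
  using finite_V parents_subset by (rule finite_subset[rotated])

lemma descendants_subset: "descendants D i \<subseteq> V"
  using path_in_V by (auto simp: descendants_def)

lemma not_in_descendants: "i \<notin> descendants D i"
  using no_directed_cycle by (simp add: descendants_def)

lemma clique_insert_parents: "i \<in> V \<Longrightarrow> insert i (parents D i) \<in> cliques V E"
  using parents_subset[of i] parents_adjacent[of _ i]
  by (auto simp: cliques_def clique_def edge_iff parents_def)

lemma clique_parents: "parents D i \<in> cliques V E"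
  using parents_subset[of i] parents_adjacent[of _ i]
  by (auto simp: cliques_def clique_def edge_iff parents_def)

lemma ex_source:
  assumes "A \<noteq> {}"
  shows "\<exists>s\<in>A. \<forall>j\<in>A. (j, s) \<notin> D"
  using wfE_min'[OF finite_acyclic_wf[OF finite_D acyclic] assms] by metis

lemma ex_sink:
  assumes "A \<noteq> {}"
  shows "\<exists>s\<in>A. \<forall>j\<in>A. (s, j) \<notin> D"
  using wfE_min'[OF finite_acyclic_wf_converse[OF finite_D acyclic] assms] by (metis converse_iff)

definition descendant_closed :: "'v set \<Rightarrow> bool" where
  "descendant_closed A \<longleftrightarrow> A \<subseteq> V \<and> (\<forall>i j. i \<in> A \<longrightarrow> (i, j) \<in> D \<longrightarrow> j \<in> A)"

lemma descendant_closed_path: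
  assumes "descendant_closed A" "(i, j) \<in> D\<^sup>+" "i \<in> A"
  shows "j \<in> A"
  using assms(2,3) by (induction) (use assms(1) in \<open>auto simp: descendant_closed_def\<close>)

lemma descendant_closed_descendants: "descendant_closed (descendants D i)"
  using descendants_subset by (auto simp: descendant_closed_def descendants_def intro: trancl_into_trancl)

lemma descendant_closed_V: "descendant_closed V"
  using arc_in_V by (auto simp: descendant_closed_def)

text \<open>
  The quotients \<open>q\<^sub>i\<close>. At \<open>y\<close> this is \<open>1 + w\<^sub>i\<close>, and at \<open>y = -x\<close> it is \<open>1 - u\<^sub>i\<close>.
\<close>

definition ratio :: "('v \<Rightarrow> real) \<Rightarrow> 'v \<Rightarrow> real" where
  "ratio y i = delta_sub E (descendants_refl D i) y / delta_sub E (descendants D i) y"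

lemma delta_sub_descendants_nonzero:
  assumes "\<And>A. A \<subseteq> V \<Longrightarrow> 0 < delta_sub E A y"
  shows "delta_sub E (descendants D i) y \<noteq> 0"
  using assms[OF descendants_subset[of i]] by simp

lemma ratio_pos:
  assumes "\<And>A. A \<subseteq> V \<Longrightarrow> 0 < delta_sub E A y" "i \<in> V"
  shows "0 < ratio y i"
  using assms descendants_subset[of i] by (simp add: ratio_def descendants_refl_def)

lemma u_param_eq: "u_param E D x i = 1 - ratio (\<lambda>i. - x i) i"
  by (simp add: u_param_def ratio_def Delta_sub_eq_delta_sub)

lemma w_param_eq: "w_param E D y i = ratio y i - 1"
  by (simp add: w_param_def ratio_def)

text \<open>
  Morality is used here. If \<open>b\<close> had an arc into a descendant of \<open>s\<close>, then \<open>b\<close> would be adjacent to the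
  predecessor on a path from \<open>s\<close>, because both are parents of the same vertex. As \<open>b\<close> is not a descendant
  of \<open>s\<close>, this edge also leaves \<open>b\<close>. Going back along the path one arrives at \<open>s\<close> itself, which has no
  parent in \<open>A\<close>.
\<close>

lemma source_separated:
  assumes A: "descendant_closed A" and s: "s \<in> A" "\<forall>j\<in>A. (j, s) \<notin> D"
    and i: "i = s \<or> (s, i) \<in> D\<^sup>+" and b: "b \<in> A" "b \<noteq> s" "(s, b) \<notin> D\<^sup>+"
  shows "(b, i) \<notin> D"
proof -
  have base: "(b, s) \<notin> D"
    using s b by blast
  have "(b, i) \<notin> D" if "(s, i) \<in> D\<^sup>+"
    using that
  proof (induction rule: trancl_induct)
    case (base j)
    show ?case
    proof
      assume "(b, j) \<in> D"
      then have "(s, b) \<in> D \<or> (b, s) \<in> D"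
        using parents_adjacent[OF base, of b] b(2) by blast
      then show False
        using b(3) \<open>(b, s) \<notin> D\<close> by blast
    qed
  next
    case (step p j)
    show ?case
    proof
      assume "(b, j) \<in> D"
      moreover have "b \<noteq> p"
        using step.hyps(1) b(3) by blast
      ultimately have "(p, b) \<in> D"
        using parents_adjacent[OF step.hyps(2), of b] step.IH by blast
      then show False
        using step.hyps(1) b(3) by (meson trancl_into_trancl)
    qed
  qed
  then show ?thesis
    using i base by blast
qed

text \<open>
  The set \<open>A\<close> splits into \<open>s\<close> with its descendants and a rest \<open>B\<close> without edges between them, so the
  factor of \<open>B\<close> is common to the polynomials of \<open>A\<close> and of \<open>A - {s}\<close>.
\<close>

lemma delta_sub_remove_source:
  assumes A: "descendant_closed A" and s: "s \<in> A" "\<forall>j\<in>A. (j, s) \<notin> D"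
    and nz: "delta_sub E (descendants D s) y \<noteq> 0"
  shows "delta_sub E A y = delta_sub E (A - {s}) y * ratio y s"
proof -
  define B where "B = A - descendants_refl D s"
  have sub: "descendants_refl D s \<subseteq> A"
    using descendant_closed_path[OF A] s(1) by (auto simp: descendants_refl_def descendants_def)
  have finA: "finite A"
    using A finite_V finite_subset by (auto simp: descendant_closed_def)
  have fin: "finite B" "finite (descendants_refl D s)" "finite (descendants D s)"
    using finA finite_subset[OF sub] by (auto simp: B_def descendants_refl_def)
  have sep: "{i, b} \<notin> E" if "i \<in> descendants_refl D s" "b \<in> B" for i b
  proof -
    have b: "b \<in> A" "b \<noteq> s" "(s, b) \<notin> D\<^sup>+"
      using that(2) by (auto simp: B_def descendants_refl_def descendants_def)
    have i: "i = s \<or> (s, i) \<in> D\<^sup>+"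
      using that(1) by (auto simp: descendants_refl_def descendants_def)
    have "(b, i) \<notin> D"
      using source_separated[OF A s i b] .
    moreover have "(i, b) \<notin> D"
      using i b(3) by (meson r_into_trancl trancl_into_trancl)
    ultimately show ?thesis
      by (simp add: edge_iff)
  qed
  have "A = descendants_refl D s \<union> B" "A - {s} = descendants D s \<union> B"
    using sub not_in_descendants[of s] by (auto simp: B_def descendants_refl_def)
  moreover have "delta_sub E (descendants_refl D s \<union> B) y =
      delta_sub E (descendants_refl D s) y * delta_sub E B y"
    using fin sep by (intro delta_sub_disconnected) (auto simp: B_def)
  moreover have "delta_sub E (descendants D s \<union> B) y = delta_sub E (descendants D s) y * delta_sub E B y"
    using fin sep by (intro delta_sub_disconnected) (auto simp: B_def descendants_refl_def)
  ultimately show ?thesis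
    using nz by (simp add: ratio_def)
qed

text \<open>
  Iteration of the preceding lemma. As \<open>S\<close> contains the parents in \<open>A\<close> of its elements, a source of \<open>S\<close>
  is a source of \<open>A\<close>, and what remains after its removal satisfies the same hypotheses.
\<close>

lemma delta_sub_remove_sources:
  assumes "descendant_closed A" "S \<subseteq> A" "\<And>i j. j \<in> S \<Longrightarrow> i \<in> A \<Longrightarrow> (i, j) \<in> D \<Longrightarrow> i \<in> S"
    and nz: "\<And>i. i \<in> V \<Longrightarrow> delta_sub E (descendants D i) y \<noteq> 0"
  shows "delta_sub E A y = delta_sub E (A - S) y * (\<Prod>i\<in>S. ratio y i)"
proof -
  have "finite S"
    using assms(1,2) finite_V by (auto simp: descendant_closed_def intro: finite_subset)
  then show ?thesis
    using assms(1-3)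
  proof (induction "card S" arbitrary: S A)
    case 0
    then show ?case by simp
  next
    case (Suc k)
    then have "S \<noteq> {}" by auto
    then obtain s where s: "s \<in> S" "\<forall>j\<in>S. (j, s) \<notin> D"
      using ex_source by blast
    have sA: "s \<in> A" "\<forall>j\<in>A. (j, s) \<notin> D"
      using s Suc.prems(3,4) by blast+
    have "descendant_closed (A - {s})"
      using Suc.prems(2) sA by (auto simp: descendant_closed_def)
    moreover have "k = card (S - {s})" "finite (S - {s})" "S - {s} \<subseteq> A - {s}"
      using Suc.hyps(2) Suc.prems s by auto
    moreover have "\<And>i j. j \<in> S - {s} \<Longrightarrow> i \<in> A - {s} \<Longrightarrow> (i, j) \<in> D \<Longrightarrow> i \<in> S - {s}"
      using Suc.prems(4) by blast
    ultimately have "delta_sub E (A - {s}) y =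
        delta_sub E (A - {s} - (S - {s})) y * (\<Prod>i\<in>S - {s}. ratio y i)"
      by (intro Suc.hyps(1))
    moreover have "A - {s} - (S - {s}) = A - S"
      using s by auto
    moreover have "delta_sub E A y = delta_sub E (A - {s}) y * ratio y s"
      using Suc.prems(2) sA nz[of s] by (intro delta_sub_remove_source) (auto simp: descendant_closed_def)
    moreover have "(\<Prod>i\<in>S. ratio y i) = ratio y s * (\<Prod>i\<in>S - {s}. ratio y i)"
      using Suc.prems(1) s(1) by (rule prod.remove)
    ultimately show ?case
      by simp
  qed
qed

lemma delta_sub_empty: "delta_sub E {} y = 1"
  by (simp add: delta_sub_eq_sum_stable_sets stable_sets_def cong: conj_cong)

lemma delta_V_eq_prod_ratio:
  assumes "\<And>i. i \<in> V \<Longrightarrow> delta_sub E (descendants D i) y \<noteq> 0"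
  shows "delta V E y = (\<Prod>i\<in>V. ratio y i)"
  using delta_sub_remove_sources[OF descendant_closed_V subset_refl, of y] assms
  by (simp add: delta_sub_empty delta_sub_eq_delta[symmetric])

definition children :: "'v \<Rightarrow> 'v set" where
  "children i = {j. (i, j) \<in> D}"

text \<open>
  Splitting off \<open>i\<close> gives \<open>q\<^sub>i - 1 = y\<^sub>i \<delta>\<^bsub>de(i) - ch(i)\<^esub> / \<delta>\<^bsub>de(i)\<^esub>\<close>, since the neighbours of \<open>i\<close> among its
  descendants are its children. By morality a parent of a child of \<open>i\<close> that descends from \<open>i\<close> is
  adjacent to \<open>i\<close>, hence again a child, so the children can be removed by the preceding lemmas.
\<close>

lemma ratio_minus_1:
  assumes i: "i \<in> V" and nz: "\<And>i. i \<in> V \<Longrightarrow> delta_sub E (descendants D i) y \<noteq> 0"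
    and nz': "\<And>j. j \<in> V \<Longrightarrow> ratio y j \<noteq> 0"
  shows "(ratio y i - 1) * (\<Prod>j\<in>children i. ratio y j) = y i"
proof -
  let ?d = "descendants D i" and ?c = "children i"
  have fin: "finite (descendants_refl D i)"
    using finite_V descendants_subset[of i] by (auto simp: descendants_refl_def intro: finite_subset)
  have d: "descendants_refl D i - {i} = ?d"
    using not_in_descendants by (auto simp: descendants_refl_def)
  have "{j \<in> ?d. {i, j} \<notin> E} = ?d - ?c"
  proof -
    have "(j, i) \<notin> D" if "j \<in> ?d" for j
      using that no_directed_cycle[of i] by (auto simp: descendants_def dest: trancl_into_trancl)
    then show ?thesis
      by (auto simp: edge_iff children_def)
  qed
  then have "delta_sub E (descendants_refl D i) y = delta_sub E ?d y + y i * delta_sub E (?d - ?c) y"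
    using delta_sub_remove[OF fin, of i E y] unfolding d by (simp add: descendants_refl_def)
  then have 1: "ratio y i - 1 = y i * delta_sub E (?d - ?c) y / delta_sub E ?d y"
    using nz[OF i] by (simp add: ratio_def field_simps)
  have 2: "delta_sub E ?d y = delta_sub E (?d - ?c) y * (\<Prod>j\<in>?c. ratio y j)"
  proof (rule delta_sub_remove_sources[OF descendant_closed_descendants])
    show "?c \<subseteq> ?d"
      by (auto simp: children_def descendants_def)
    show "k \<in> ?c" if "j \<in> ?c" "k \<in> ?d" "(k, j) \<in> D" for k j
    proof -
      have "k \<noteq> i" "(k, i) \<notin> D"
        using that(2) no_directed_cycle[of i] by (auto simp: descendants_def dest: trancl_into_trancl)
      then show ?thesis
        using parents_adjacent[of i j k] that by (auto simp: children_def)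
    qed
  qed (use nz in auto)
  show ?thesis
    unfolding 1 using 2 nz[OF i] by auto
qed

text \<open>
  The factor \<open>q\<^sub>j\<close> occurs with exponent \<open>n\<^sub>i\<close> for every arc from \<open>i\<close> to \<open>j\<close>; collecting the arcs by their
  end points instead of their starting points gives the exponent \<open>|n\<^bsub>pa(j)\<^esub>|\<close>.
\<close>

lemma monomial_eq_prod_ratio:
  fixes n :: "'v \<Rightarrow> nat"
  assumes nz: "\<And>i. i \<in> V \<Longrightarrow> delta_sub E (descendants D i) y \<noteq> 0"
    and nz': "\<And>j. j \<in> V \<Longrightarrow> ratio y j \<noteq> 0"
  shows "(\<Prod>i\<in>V. y i ^ n i) =
    (\<Prod>i\<in>V. (ratio y i - 1) ^ n i * ratio y i ^ (\<Sum>j\<in>parents D i. n j))"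
proof -
  have ch: "children i = {j \<in> V. (i, j) \<in> D}" and pa: "parents D i = {j \<in> V. (j, i) \<in> D}" for i
    using arc_in_V by (auto simp: children_def parents_def)
  have "(\<Prod>i\<in>V. \<Prod>j\<in>children i. ratio y j ^ n i) = (\<Prod>i\<in>V. \<Prod>j\<in>parents D i. ratio y i ^ n j)"
    unfolding ch pa by (rule prod.swap_restrict[OF finite_V finite_V])
  then have "(\<Prod>i\<in>V. (\<Prod>j\<in>children i. ratio y j) ^ n i) = (\<Prod>i\<in>V. ratio y i ^ (\<Sum>j\<in>parents D i. n j))"
    by (simp add: prod_power_distrib power_sum)
  moreover have "(\<Prod>i\<in>V. y i ^ n i) = (\<Prod>i\<in>V. ((ratio y i - 1) * (\<Prod>j\<in>children i. ratio y j)) ^ n i)"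
    using ratio_minus_1 nz nz' by (intro prod.cong) auto
  ultimately show ?thesis
    by (simp add: power_mult_distrib prod.distrib)
qed

end


section \<open>Maximal cliques\<close>

lemma finite_cliques: "finite V \<Longrightarrow> finite (cliques V E)"
  by (rule finite_subset[of _ "Pow V"]) (auto simp: cliques_def)

lemma finite_maximal_cliques: "finite V \<Longrightarrow> finite (maximal_cliques V E)"
  using finite_cliques by (rule finite_subset[rotated]) (auto simp: maximal_cliques_def)

lemma clique_extends_to_maximal:
  assumes "finite V" "C \<in> cliques V E"
  obtains C' where "C' \<in> maximal_cliques V E" "C \<subseteq> C'"
  using finite_has_maximal2[OF finite_cliques[OF assms(1)] assms(2)]
  by (auto simp: maximal_cliques_def)

lemma weight_clique_le:
  assumes V: "finite V" and n: "n \<in> bounded_multi_indices V E r" and C: "C \<in> cliques V E"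
  shows "weight C n \<le> r"
proof -
  obtain C' where C': "C' \<in> maximal_cliques V E" "C \<subseteq> C'"
    using clique_extends_to_maximal[OF V C] .
  then have "weight C n \<le> weight C' n"
    using V unfolding weight_def
    by (intro sum_mono2) (auto simp: maximal_cliques_def cliques_def intro: finite_subset)
  also have "\<dots> \<le> Max ((\<lambda>C. weight C n) ` maximal_cliques V E)"
    using C' finite_maximal_cliques[OF V] by (intro Max_ge) auto
  finally show ?thesis
    using n by (simp add: bounded_multi_indices_def)
qed


section \<open>Multicolourings\<close>

definition multicolourings :: "'v set set \<Rightarrow> 'v set \<Rightarrow> nat \<Rightarrow> ('v \<Rightarrow> nat set) set" where
  "multicolourings E A r = {c \<in> PiE A (\<lambda>_. Pow {..<r}).
     \<forall>i\<in>A. \<forall>j\<in>A. i \<noteq> j \<longrightarrow> {i, j} \<in> E \<longrightarrow> c i \<inter> c j = {}}"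

lemma finite_multicolourings: "finite A \<Longrightarrow> finite (multicolourings E A r)"
  unfolding multicolourings_def by (simp add: finite_PiE)

text \<open>
  Multiplying out \<open>\<delta>\<^sup>r\<close> chooses a stable set for each of the \<open>r\<close> factors. Read the factors as colours: a
  vertex is given the set of all factors whose stable set contains it, and stability means that adjacent
  vertices never share a colour. The identity holds in every commutative semiring, so that it applies to
  real numbers and to indeterminates.
\<close>

lemma delta_power_eq_sum_multicolourings:
  fixes y :: "'v \<Rightarrow> 'a::comm_semiring_1"
  assumes A: "finite A"
  shows "delta A E y ^ r = (\<Sum>c\<in>multicolourings E A r. \<Prod>i\<in>A. y i ^ card (c i))"
proof -
  have "delta A E y ^ r = (\<Prod>t<r. \<Sum>C\<in>stable_sets E A. \<Prod>i\<in>C. y i)"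
    by (simp add: delta_eq_sum_stable_sets)
  also have "\<dots> = (\<Sum>f\<in>PiE {..<r} (\<lambda>_. stable_sets E A). \<Prod>t<r. \<Prod>i\<in>f t. y i)"
    using A by (intro prod_sum_PiE) (auto simp: finite_stable_sets)
  also have "\<dots> = (\<Sum>c\<in>multicolourings E A r. \<Prod>i\<in>A. y i ^ card (c i))"
  proof (rule sum.reindex_bij_witness[where i = "\<lambda>c. \<lambda>t\<in>{..<r}. {i \<in> A. t \<in> c i}"
        and j = "\<lambda>f. \<lambda>i\<in>A. {t \<in> {..<r}. i \<in> f t}"])
    fix f assume f: "f \<in> PiE {..<r} (\<lambda>_. stable_sets E A)"
    have fA: "f t \<subseteq> A" if "t < r" for t
      using f that by (auto simp: stable_sets_def PiE_iff)
    show "(\<lambda>t\<in>{..<r}. {i \<in> A. t \<in> (\<lambda>i\<in>A. {t \<in> {..<r}. i \<in> f t}) i}) = f"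
    proof
      fix t
      show "(\<lambda>t\<in>{..<r}. {i \<in> A. t \<in> (\<lambda>i\<in>A. {t \<in> {..<r}. i \<in> f t}) i}) t = f t"
        using fA[of t] f by (cases "t < r") (auto simp: PiE_arb[OF f])
    qed
    show "(\<lambda>i\<in>A. {t \<in> {..<r}. i \<in> f t}) \<in> multicolourings E A r"
      using f by (auto simp: multicolourings_def stable_sets_def PiE_iff)
    have "(\<Prod>t<r. \<Prod>i\<in>f t. y i) = (\<Prod>t<r. \<Prod>i\<in>{i \<in> A. i \<in> f t}. y i)"
      using fA by (intro prod.cong) auto
    also have "\<dots> = (\<Prod>i\<in>A. \<Prod>t\<in>{t \<in> {..<r}. i \<in> f t}. y i)"
      using A by (intro prod.swap_restrict) auto
    finally show "(\<Prod>i\<in>A. y i ^ card ((\<lambda>i\<in>A. {t \<in> {..<r}. i \<in> f t}) i)) = (\<Prod>t<r. \<Prod>i\<in>f t. y i)"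
      by simp
  next
    fix c assume c: "c \<in> multicolourings E A r"
    then have cP: "c \<in> PiE A (\<lambda>_. Pow {..<r})"
      by (simp add: multicolourings_def)
    show "(\<lambda>i\<in>A. {t \<in> {..<r}. i \<in> (\<lambda>t\<in>{..<r}. {i \<in> A. t \<in> c i}) t}) = c"
    proof
      fix i
      show "(\<lambda>i\<in>A. {t \<in> {..<r}. i \<in> (\<lambda>t\<in>{..<r}. {i \<in> A. t \<in> c i}) t}) i = c i"
        using cP by (cases "i \<in> A") (auto simp: PiE_iff PiE_arb[OF cP])
    qed
    show "(\<lambda>t\<in>{..<r}. {i \<in> A. t \<in> c i}) \<in> PiE {..<r} (\<lambda>_. stable_sets E A)"
      using c by (auto simp: multicolourings_def stable_sets_def PiE_iff disjoint_iff)
  qed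
  finally show ?thesis .
qed

definition colouring_count :: "'v set set \<Rightarrow> 'v set \<Rightarrow> nat \<Rightarrow> ('v \<Rightarrow> nat) \<Rightarrow> nat" where
  "colouring_count E A r n = card {c \<in> multicolourings E A r. \<forall>i\<in>A. card (c i) = n i}"

lemma card_colours_of_clique:
  assumes c: "c \<in> multicolourings E A r" and S: "S \<subseteq> A" "clique S E" "finite S"
  shows "card (\<Union>i\<in>S. c i) = (\<Sum>i\<in>S. card (c i))" "(\<Union>i\<in>S. c i) \<subseteq> {..<r}"
proof -
  show sub: "(\<Union>i\<in>S. c i) \<subseteq> {..<r}"
    using c S(1) by (auto simp: multicolourings_def PiE_iff)
  have "finite (c i)" if "i \<in> S" for i
    using that sub by (meson UN_upper finite_lessThan finite_subset)
  moreover have "c i \<inter> c j = {}" if "i \<in> S" "j \<in> S" "i \<noteq> j" for i j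
    using c S(1,2) that unfolding multicolourings_def clique_def by blast
  ultimately show "card (\<Union>i\<in>S. c i) = (\<Sum>i\<in>S. card (c i))"
    using S(3) by (intro card_UN_disjoint) auto
qed

lemma clique_weight_le:
  assumes "colouring_count E A r n \<noteq> 0" "S \<subseteq> A" "clique S E" "finite S"
  shows "(\<Sum>i\<in>S. n i) \<le> r"
proof -
  obtain c where c: "c \<in> multicolourings E A r" "\<forall>i\<in>A. card (c i) = n i"
  proof -
    have "{c \<in> multicolourings E A r. \<forall>i\<in>A. card (c i) = n i} \<noteq> {}"
      using assms(1) unfolding colouring_count_def by (metis card.empty)
    then show ?thesis using that by blast
  qed
  have "(\<Sum>i\<in>S. n i) = (\<Sum>i\<in>S. card (c i))"
    using c(2) assms(2) by (intro sum.cong) auto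
  also have "\<dots> = card (\<Union>i\<in>S. c i)"
    using card_colours_of_clique(1)[OF c(1) assms(2,3,4)] by simp
  also have "\<dots> \<le> card {..<r}"
    using card_colours_of_clique(2)[OF c(1) assms(2,3,4)] by (intro card_mono) auto
  finally show ?thesis by simp
qed

text \<open>
  The scalar \<open>a\<close> is \<open>1\<close> for the powers of \<open>\<delta>\<close> and \<open>-1\<close> for those of \<open>\<Delta>\<close>.
\<close>

lemma lookup_delta_power:
  fixes a :: real
  assumes A: "finite A" and n: "Poly_Mapping.keys n \<subseteq> A"
  shows "Poly_Mapping.lookup
      (delta A E (\<lambda>i. Poly_Mapping.single (Poly_Mapping.single i 1) a) ^ r) n =
    a ^ weight A n * real (colouring_count E A r (Poly_Mapping.lookup n))"
proof -
  let ?x = "\<lambda>i. Poly_Mapping.single (Poly_Mapping.single i (1::nat)) a"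
  let ?C = "multicolourings E A r"
  let ?e = "\<lambda>c::'a \<Rightarrow> nat set. \<Sum>i\<in>A. Poly_Mapping.single i (card (c i))"
  have pow: "?x i ^ k = Poly_Mapping.single (Poly_Mapping.single i k) (a ^ k)" for i k
    by (induction k) (simp_all add: mult_single single_add[symmetric])
  have prod: "(\<Prod>i\<in>S. Poly_Mapping.single (Poly_Mapping.single i (f i)) (a ^ f i)) =
      Poly_Mapping.single (\<Sum>i\<in>S. Poly_Mapping.single i (f i)) (a ^ sum f S)"
    if "finite S" for S :: "'a set" and f
    using that by (induction S rule: finite_induct) (auto simp: mult_single power_add)
  have e: "?e c = n \<longleftrightarrow> (\<forall>i\<in>A. card (c i) = Poly_Mapping.lookup n i)" for c
  proof -
    have "Poly_Mapping.lookup (?e c) i = (if i \<in> A then card (c i) else 0)" for i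
      using A by (simp add: lookup_sum lookup_single when_def)
    moreover have "Poly_Mapping.lookup n i = 0" if "i \<notin> A" for i
      using n that by (auto simp: in_keys_iff)
    ultimately show ?thesis
      by (auto simp: poly_mapping_eq_iff fun_eq_iff)
  qed
  have "Poly_Mapping.lookup (delta A E ?x ^ r) n =
      (\<Sum>c\<in>?C. Poly_Mapping.lookup (Poly_Mapping.single (?e c) (a ^ (\<Sum>i\<in>A. card (c i)))) n)"
    unfolding delta_power_eq_sum_multicolourings[OF A] lookup_sum pow prod[OF A] ..
  also have "\<dots> = (\<Sum>c\<in>?C. if \<forall>i\<in>A. card (c i) = Poly_Mapping.lookup n i then a ^ weight A n else 0)"
    by (intro sum.cong) (auto simp: lookup_single when_def e weight_def)
  also have "\<dots> = a ^ weight A n * real (colouring_count E A r (Poly_Mapping.lookup n))"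
    using A by (simp add: sum.If_cases finite_multicolourings colouring_count_def Int_def)
  finally show ?thesis .
qed

lemma mult_coeff_eq_colouring_count:
  assumes "finite V" "n \<in> multi_indices V"
  shows "mult_coeff V E r n = real (colouring_count E V r (Poly_Mapping.lookup n))"
  using lookup_delta_power[OF assms(1), of n E 1 r] assms(2)
  by (simp add: mult_coeff_def indet_def[abs_def] multi_indices_def)

lemma lookup_Delta_power:
  assumes "finite V" "n \<in> multi_indices V"
  shows "Poly_Mapping.lookup (Delta V E indet ^ r) n =
    (-1) ^ weight V n * real (colouring_count E V r (Poly_Mapping.lookup n))"
  using lookup_delta_power[OF assms(1), of n E "-1" r] assms(2)
  by (simp add: Delta_eq_delta indet_def multi_indices_def single_uminus)

lemma card_extend_multicolouring:
  assumes c: "c \<in> multicolourings E A r" and v: "v \<notin> A" and A: "finite A"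
    and P: "P = {j \<in> A. {j, v} \<in> E}" "clique P E"
  shows "card {T. T \<subseteq> {..<r} - (\<Union>j\<in>P. c j) \<and> card T = k} = (r - (\<Sum>j\<in>P. card (c j))) choose k"
proof -
  have P': "P \<subseteq> A" "finite P"
    using P(1) A by auto
  note u = card_colours_of_clique[OF c P'(1) P(2) P'(2)]
  have "card ({..<r} - (\<Union>j\<in>P. c j)) = r - (\<Sum>j\<in>P. card (c j))"
    using u by (subst card_Diff_subset) (auto intro: finite_subset)
  then show ?thesis
    by (subst n_subsets) simp_all
qed

text \<open>
  When the neighbours of \<open>v\<close> in \<open>A\<close> form a clique, their colour sets are disjoint, so the number of
  colours left for \<open>v\<close> is the same for every multicolouring of \<open>A\<close> with the given sizes. If the neighbours
  need more than \<open>r\<close> colours, the truncated subtraction is harmless, as there is then no multicolouring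
  of \<open>A\<close> either.
\<close>

lemma colouring_count_insert:
  assumes v: "v \<notin> A" and A: "finite A" and P: "P = {j \<in> A. {j, v} \<in> E}" "clique P E"
  shows "colouring_count E (insert v A) r n = ((r - (\<Sum>j\<in>P. n j)) choose n v) * colouring_count E A r n"
proof -
  let ?S = "{c \<in> multicolourings E A r. \<forall>i\<in>A. card (c i) = n i}"
  let ?T = "\<lambda>c. {T. T \<subseteq> {..<r} - (\<Union>j\<in>P. c j) \<and> card T = n v}"
  have "colouring_count E (insert v A) r n = card (SIGMA c:?S. ?T c)"
    unfolding colouring_count_def
  proof (rule bij_betw_same_card[OF bij_betwI[where f = "\<lambda>c. (restrict c A, c v)"
          and g = "\<lambda>(c, T). c(v := T)"]])
    let ?L = "{c \<in> multicolourings E (insert v A) r. \<forall>i\<in>insert v A. card (c i) = n i}"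
    show "(\<lambda>c. (restrict c A, c v)) \<in> ?L \<rightarrow> (SIGMA c:?S. ?T c)"
    proof
      fix c assume c: "c \<in> ?L"
      have "restrict c A \<in> ?S"
        using c by (auto simp: multicolourings_def PiE_iff)
      moreover have "c v \<in> ?T (restrict c A)"
        using c v unfolding multicolourings_def P(1) PiE_iff
        by (auto simp: insert_commute)
      ultimately show "(restrict c A, c v) \<in> (SIGMA c:?S. ?T c)"
        by blast
    qed
    show "(\<lambda>(c, T). c(v := T)) \<in> (SIGMA c:?S. ?T c) \<rightarrow> ?L"
    proof
      fix p assume "p \<in> (SIGMA c:?S. ?T c)"
      then obtain c T where p: "p = (c, T)" and c: "c \<in> ?S" and T: "T \<in> ?T c"
        by blast
      have "c(v := T) \<in> PiE (insert v A) (\<lambda>_. Pow {..<r})"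
        using c T v by (auto simp: multicolourings_def PiE_iff extensional_def)
      moreover have "(c(v := T)) i \<inter> (c(v := T)) j = {}"
        if "i \<in> insert v A" "j \<in> insert v A" "i \<noteq> j" "{i, j} \<in> E" for i j
      proof -
        have "T \<inter> c k = {}" if "k \<in> A" "{k, v} \<in> E" for k
          using T that P(1) by blast
        moreover have "c i \<inter> c j = {}" if "i \<in> A" "j \<in> A"
          using c that \<open>i \<noteq> j\<close> \<open>{i, j} \<in> E\<close> by (simp add: multicolourings_def)
        ultimately show ?thesis
          using that v by (cases "i = v"; cases "j = v") (simp_all add: insert_commute Int_commute)
      qed
      moreover have "\<forall>i\<in>insert v A. card ((c(v := T)) i) = n i"
        using c T v by auto
      ultimately show "(case p of (c, T) \<Rightarrow> c(v := T)) \<in> ?L"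
        unfolding p multicolourings_def by (simp only: mem_Collect_eq case_prod_conv) blast
    qed
    show "(case (restrict c A, c v) of (c, T) \<Rightarrow> c(v := T)) = c" if "c \<in> ?L" for c
      using that by (auto simp: multicolourings_def PiE_iff extensional_def fun_eq_iff)
    show "(restrict ((\<lambda>(c, T). c(v := T)) p) A, ((\<lambda>(c, T). c(v := T)) p) v) = p"
      if "p \<in> (SIGMA c:?S. ?T c)" for p
      using that v by (auto simp: multicolourings_def PiE_iff extensional_def fun_eq_iff)
  qed
  also have "\<dots> = (\<Sum>c\<in>?S. card (?T c))"
    using A by (intro card_SigmaI) (auto simp: finite_multicolourings)
  also have "\<dots> = (\<Sum>c\<in>?S. (r - (\<Sum>j\<in>P. n j)) choose n v)"
  proof (rule sum.cong[OF refl])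
    fix c assume c: "c \<in> ?S"
    have "(\<Sum>j\<in>P. card (c j)) = (\<Sum>j\<in>P. n j)"
      using c P(1) by (intro sum.cong) auto
    then show "card (?T c) = (r - (\<Sum>j\<in>P. n j)) choose n v"
      using card_extend_multicolouring[OF _ v A P, of c r "n v"] c by simp
  qed
  finally show ?thesis
    by (simp add: colouring_count_def)
qed

context moral_DAG_graph
begin

definition ancestral :: "'v set \<Rightarrow> bool" where
  "ancestral A \<longleftrightarrow> A \<subseteq> V \<and> (\<forall>i\<in>A. parents D i \<subseteq> A)"

lemma finite_ancestral: "ancestral A \<Longrightarrow> finite A"
  using finite_V by (auto simp: ancestral_def intro: finite_subset)

lemma ancestral_V: "ancestral V"
  using parents_subset by (simp add: ancestral_def)

lemma ancestral_remove_sink: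
  "ancestral A \<Longrightarrow> \<forall>j\<in>A. (v, j) \<notin> D \<Longrightarrow> ancestral (A - {v})"
  by (auto simp: ancestral_def parents_def)

text \<open>
  A sink \<open>v\<close> of an ancestral set has as neighbours there exactly its parents, which are a clique by
  morality; so it can be coloured last.
\<close>

lemma colouring_count_eq_prod:
  assumes "ancestral A"
  shows "colouring_count E A r n = (\<Prod>i\<in>A. (r - (\<Sum>j\<in>parents D i. n j)) choose n i)"
  using assms
proof (induction "card A" arbitrary: A)
  case 0
  then have "A = {}"
    using finite_ancestral by simp
  moreover have "multicolourings E {} r = {\<lambda>_. undefined}"
    by (auto simp: multicolourings_def)
  ultimately show ?case
    by (simp add: colouring_count_def)
next
  case (Suc k)
  have "A \<noteq> {}" and fin: "finite A"
    using Suc.hyps(2) finite_ancestral[OF Suc.prems] by auto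
  then obtain v where v: "v \<in> A" "\<forall>j\<in>A. (v, j) \<notin> D"
    using ex_sink by blast
  have "parents D v = {j \<in> A - {v}. {j, v} \<in> E}"
    using v Suc.prems no_loop[of v] by (auto simp: edge_iff parents_def ancestral_def)
  moreover have "clique (parents D v) E"
    using clique_parents by (simp add: cliques_def)
  ultimately have "colouring_count E (insert v (A - {v})) r n =
      ((r - (\<Sum>j\<in>parents D v. n j)) choose n v) * colouring_count E (A - {v}) r n"
    using fin by (intro colouring_count_insert) auto
  also have "colouring_count E (A - {v}) r n =
      (\<Prod>i\<in>A - {v}. (r - (\<Sum>j\<in>parents D i. n j)) choose n i)"
    using Suc.hyps(2) v fin ancestral_remove_sink[OF Suc.prems v(2)] by (intro Suc.hyps(1)) auto
  finally show ?case
    using v(1) fin by (simp add: insert_absorb prod.remove)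
qed

lemma mult_coeff_eq_prod:
  assumes "n \<in> multi_indices V"
  shows "mult_coeff V E r n =
    (\<Prod>i\<in>V. real ((r - weight (parents D i) n) choose Poly_Mapping.lookup n i))"
  using mult_coeff_eq_colouring_count[OF finite_V assms, of E r]
  by (simp add: colouring_count_eq_prod[OF ancestral_V] weight_def)

lemma mult_coeff_nonzero_imp_bounded:
  assumes n: "n \<in> multi_indices V" and nz: "mult_coeff V E r n \<noteq> 0"
  shows "n \<in> bounded_multi_indices V E r"
proof -
  have "weight C n \<le> r" if "C \<in> cliques V E" for C
    using clique_weight_le[of E V r "Poly_Mapping.lookup n" C] that nz finite_V
      mult_coeff_eq_colouring_count[OF finite_V n, of E r]
    by (auto simp: cliques_def weight_def intro: finite_subset)
  moreover have "finite (maximal_cliques V E)" "maximal_cliques V E \<noteq> {}"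
    using finite_maximal_cliques[OF finite_V] clique_extends_to_maximal[OF finite_V clique_parents]
    by auto
  ultimately show ?thesis
    using n by (auto simp: bounded_multi_indices_def maximal_cliques_def)
qed

end


section \<open>The coefficients of real powers\<close>

text \<open>
  Polynomial functions are determined by their values at the large negative integers, which is where
  \<open>\<Delta>\<^bsup>-r\<^esup>\<close> is an ordinary power of a polynomial.
\<close>

lemma real_polynomial_functions_eq:
  assumes "real_polynomial_function f" "real_polynomial_function g"
    and eq: "\<And>m. k \<le> m \<Longrightarrow> f (- real m) = g (- real m)"
  shows "f x = g x"
proof -
  have "real_polynomial_function (\<lambda>x. f x - g x)"
    using assms(1,2) by (rule real_polynomial_function_diff)
  then obtain a d where p: "(\<lambda>x. f x - g x) = (\<lambda>x. \<Sum>i\<le>d. a i * x ^ i)"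
    using real_polynomial_function_imp_sum by blast
  have "(\<lambda>m. - real m) ` {k..} \<subseteq> {x. (\<Sum>i\<le>d. a i * x ^ i) = 0}"
    using eq by (auto simp flip: fun_cong[OF p])
  moreover have "infinite ((\<lambda>m. - real m) ` {k..})"
    by (subst finite_image_iff) (auto simp: inj_on_def infinite_Ici)
  ultimately have "infinite {x. (\<Sum>i\<le>d. a i * x ^ i) = 0}"
    using infinite_super by blast
  then have "\<forall>i\<le>d. a i = 0"
    using polyfun_finite_roots[where c = a and n = d] by blast
  then have "(\<Sum>i\<le>d. a i * x ^ i) = 0"
    by simp
  then show ?thesis
    using fun_cong[OF p, of x] by simp
qed

lemma real_polynomial_function_id: "real_polynomial_function (\<lambda>x::real. x)"
  by (intro real_polynomial_function.intros(1) bounded_linear_ident)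

lemma real_polynomial_function_pochhammer:
  assumes "real_polynomial_function f"
  shows "real_polynomial_function (\<lambda>x. pochhammer (f x) k)"
  unfolding pochhammer_prod using assms by (intro real_polynomial_function_prod) auto

lemma real_polynomial_function_gchoose_neg: "real_polynomial_function (\<lambda>x. (- x) gchoose k)"
  unfolding gbinomial_pochhammer
  using real_polynomial_function_pochhammer[OF real_polynomial_function_id]
  by (intro real_polynomial_function_divide real_polynomial_function.intros(2,4)) simp

text \<open>
  The defining sum stops at \<open>k = |n|\<close>. For \<open>m \<ge> |n|\<close> it agrees with the full binomial expansion of
  \<open>(1 + (\<Delta> - 1))\<^sup>m\<close>, because the terms beyond \<open>|n|\<close> do not contribute.
\<close>

lemma nm_coeff_neg:
  assumes V: "finite V" and n: "n \<in> multi_indices V" and m: "weight V n \<le> m"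
  shows "nm_coeff V E (- real m) n =
    (-1) ^ weight V n * real (colouring_count E V m (Poly_Mapping.lookup n))"
proof -
  let ?L = "Delta V E indet - 1 :: ('a \<Rightarrow>\<^sub>0 nat) \<Rightarrow>\<^sub>0 real"
  have lookup_of_nat_mult: "Poly_Mapping.lookup (of_nat c * p) n = real c * Poly_Mapping.lookup p n"
    for c and p :: "('a \<Rightarrow>\<^sub>0 nat) \<Rightarrow>\<^sub>0 real"
    by (induction c) (simp_all add: lookup_add algebra_simps)
  have "Poly_Mapping.lookup (Delta V E indet ^ m) n = Poly_Mapping.lookup ((?L + 1) ^ m) n"
    by simp
  also have "\<dots> = (\<Sum>k\<le>m. real (m choose k) * Poly_Mapping.lookup (?L ^ k) n)"
    by (simp only: binomial_ring lookup_sum power_one mult_1_right lookup_of_nat_mult)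
  also have "\<dots> = (\<Sum>k\<le>weight V n. real (m choose k) * Poly_Mapping.lookup (?L ^ k) n)"
    using m by (intro sum.mono_neutral_right) (auto simp: lookup_Delta_power_eq_0[OF V])
  also have "\<dots> = nm_coeff V E (- real m) n"
    by (simp add: nm_coeff_def binomial_gbinomial)
  finally show ?thesis
    using lookup_Delta_power[OF V n, of E m] by simp
qed

lemma pochhammer_neg_nat:
  assumes "s \<le> m"
  shows "pochhammer (- real m + real s) k / fact k = (-1) ^ k * real ((m - s) choose k)"
proof -
  have "real ((m - s) choose k) = (-1) ^ k * pochhammer (- real m + real s) k / fact k"
    using assms by (simp add: binomial_gbinomial gbinomial_pochhammer of_nat_diff)
  then show ?thesis
    by (simp add: mult.assoc[symmetric] power_mult_distrib[symmetric])
qed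

lemma (in moral_DAG_graph) nm_coeff_eq_prod:
  assumes n: "n \<in> multi_indices V"
  shows "nm_coeff V E r n =
    (\<Prod>i\<in>V. pochhammer (r + real (weight (parents D i) n)) (Poly_Mapping.lookup n i)
      / fact (Poly_Mapping.lookup n i))"
proof -
  let ?p = "\<lambda>r. \<Prod>i\<in>V. pochhammer (r + real (weight (parents D i) n)) (Poly_Mapping.lookup n i)
      / fact (Poly_Mapping.lookup n i)"
  show ?thesis
  proof (rule real_polynomial_functions_eq[where f = "\<lambda>r. nm_coeff V E r n" and g = ?p
        and k = "weight V n"])
    show "real_polynomial_function (\<lambda>r. nm_coeff V E r n)"
      unfolding nm_coeff_def
      by (intro real_polynomial_function_sum 
          real_polynomial_function.intros(2,4) real_polynomial_function_gchoose_neg) auto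
    show "real_polynomial_function ?p"
      by (intro real_polynomial_function_prod real_polynomial_function_divide finite_V
          real_polynomial_function_pochhammer real_polynomial_function.intros(2,3)
          real_polynomial_function_id)
    fix m assume m: "weight V n \<le> m"
    have "weight (parents D i) n \<le> m" for i
      using m sum_mono2[OF finite_V parents_subset[of i], of "Poly_Mapping.lookup n"]
      by (simp add: weight_def)
    then have "?p (- real m) = (\<Prod>i\<in>V. (-1) ^ Poly_Mapping.lookup n i *
        real ((m - weight (parents D i) n) choose Poly_Mapping.lookup n i))"
      by (intro prod.cong refl pochhammer_neg_nat)
    also have "\<dots> = (-1) ^ weight V n * real (colouring_count E V m (Poly_Mapping.lookup n))"
      by (simp add: colouring_count_eq_prod[OF ancestral_V] prod.distrib weight_def power_sum)
    finally show "nm_coeff V E (- real m) n = ?p (- real m)"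
      using nm_coeff_neg[OF finite_V n m] by simp
  qed
qed


section \<open>Recursive factorization along the directed graph\<close>

lemma count_space_event:
  assumes "N \<in> M \<rightarrow>\<^sub>M count_space B"
  shows "{\<omega> \<in> space M. Q (N \<omega>)} \<in> sets M"
proof -
  have "N -` {n \<in> B. Q n} \<inter> space M \<in> sets M"
    by (rule measurable_sets[OF assms]) auto
  moreover have "N -` {n \<in> B. Q n} \<inter> space M = {\<omega> \<in> space M. Q (N \<omega>)}"
    using measurable_space[OF assms] by auto
  ultimately show ?thesis by simp
qed

text \<open>
  The factor of \<open>i\<close> depends on the parents only through the sum of their values. That it is a
  probability distribution in its last argument is required for every value \<open>s\<close> of this sum, including
  those of probability zero.
\<close>

locale DAG_factorization = moral_DAG_graph V E D + prob_space M
  for V :: "'v set" and E D and M :: "'b measure" +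
  fixes N :: "'b \<Rightarrow> 'v \<Rightarrow>\<^sub>0 nat" and \<kappa> :: "'v \<Rightarrow> nat \<Rightarrow> nat \<Rightarrow> real"
  assumes measurable_N: "N \<in> M \<rightarrow>\<^sub>M count_space (multi_indices V)"
    and factorization: "\<And>n. n \<in> multi_indices V \<Longrightarrow>
      \<P>(\<omega> in M. N \<omega> = n) = (\<Prod>i\<in>V. \<kappa> i (weight (parents D i) n) (Poly_Mapping.lookup n i))"
    and kernel_sums: "\<And>i s. i \<in> V \<Longrightarrow> \<kappa> i s sums 1"
begin

lemma N_event: "{\<omega> \<in> space M. Q (N \<omega>)} \<in> sets M"
  using measurable_N by (rule count_space_event)

text \<open>
  The values are prescribed by a function rather than by a multi-index, since they are modified one
  coordinate at a time and the coordinates outside \<open>S\<close> are irrelevant.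
\<close>

definition marginal :: "'v set \<Rightarrow> ('v \<Rightarrow> nat) \<Rightarrow> real" where
  "marginal S m = \<P>(\<omega> in M. \<forall>j\<in>S. Poly_Mapping.lookup (N \<omega>) j = m j)"

lemma marginal_sums:
  assumes "v \<notin> S"
  shows "(\<lambda>k. marginal (insert v S) (m(v := k))) sums marginal S m"
proof -
  let ?A = "\<lambda>k. {\<omega> \<in> space M. \<forall>j\<in>insert v S. Poly_Mapping.lookup (N \<omega>) j = (m(v := k)) j}"
  have "(\<lambda>k. measure M (?A k)) sums measure M (\<Union>k. ?A k)"
  proof (rule finite_measure_UNION)
    show "range ?A \<subseteq> sets M"
      using N_event[of "\<lambda>n. \<forall>j\<in>insert v S. Poly_Mapping.lookup n j = (m(v := k)) j" for k]
      by (intro image_subsetI)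
    show "disjoint_family ?A"
      by (auto simp: disjoint_family_on_def)
  qed
  moreover have "(\<Union>k. ?A k) = {\<omega> \<in> space M. \<forall>j\<in>S. Poly_Mapping.lookup (N \<omega>) j = m j}"
    using assms by auto
  ultimately show ?thesis
    by (simp only: marginal_def)
qed

lemma marginal_V: "marginal V m = (\<Prod>i\<in>V. \<kappa> i (\<Sum>j\<in>parents D i. m j) (m i))"
proof -
  define n where "n = (\<Sum>i\<in>V. Poly_Mapping.single i (m i))"
  have lookup_n: "Poly_Mapping.lookup n i = (if i \<in> V then m i else 0)" for i
    using finite_V by (simp add: n_def lookup_sum lookup_single when_def)
  have n: "n \<in> multi_indices V"
    by (auto simp: multi_indices_def in_keys_iff lookup_n split: if_splits)
  have "N \<omega> = n \<longleftrightarrow> (\<forall>j\<in>V. Poly_Mapping.lookup (N \<omega>) j = m j)" if "\<omega> \<in> space M" for \<omega>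
  proof -
    have "Poly_Mapping.lookup (N \<omega>) j = 0" if "j \<notin> V" for j
      using that measurable_space[OF measurable_N \<open>\<omega> \<in> space M\<close>]
      by (auto simp: multi_indices_def in_keys_iff)
    then show ?thesis
      by (auto simp: poly_mapping_eq_iff fun_eq_iff lookup_n)
  qed
  then have "marginal V m = \<P>(\<omega> in M. N \<omega> = n)"
    unfolding marginal_def by (intro arg_cong[where f = "measure M"]) auto
  also have "\<dots> = (\<Prod>i\<in>V. \<kappa> i (\<Sum>j\<in>parents D i. m j) (m i))"
  proof -
    have "weight (parents D i) n = (\<Sum>j\<in>parents D i. m j)" for i
      unfolding weight_def using parents_subset by (intro sum.cong) (auto simp: lookup_n)
    then show ?thesis
      by (simp add: factorization[OF n] lookup_n)
  qed
  finally show ?thesis .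
qed

text \<open>
  The complement of \<open>A\<close> is refilled starting from a source \<open>v\<close> of it, for which \<open>A\<close> with \<open>v\<close> added is
  again ancestral. No vertex of this set has \<open>v\<close> as a parent, so \<open>v\<close> enters only its own factor,
  which sums to \<open>1\<close>.
\<close>

lemma marginal_ancestral:
  assumes "ancestral A"
  shows "marginal A m = (\<Prod>i\<in>A. \<kappa> i (\<Sum>j\<in>parents D i. m j) (m i))"
  using assms
proof (induction "card (V - A)" arbitrary: A m)
  case 0
  then have "A = V"
    using finite_V by (auto simp: ancestral_def)
  then show ?case
    using marginal_V by simp
next
  case (Suc k)
  have "V - A \<noteq> {}"
    using Suc.hyps(2) by (metis card.empty nat.distinct(1))
  from ex_source[OF this]
  obtain v where v: "v \<in> V" "v \<notin> A" "\<forall>j\<in>V - A. (j, v) \<notin> D"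
    by blast
  have anc: "ancestral (insert v A)"
    using v Suc.prems parents_subset[of v] by (auto simp: ancestral_def parents_def)
  have "V - insert v A = (V - A) - {v}"
    by blast
  then have "card (V - insert v A) = k"
    using Suc.hyps(2) v finite_V by simp
  then have IH: "marginal (insert v A) m' = (\<Prod>i\<in>insert v A. \<kappa> i (\<Sum>j\<in>parents D i. m' j) (m' i))" for m'
    using anc by (intro Suc.hyps(1)) auto
  have pa: "(\<Sum>j\<in>parents D i. (m(v := l)) j) = (\<Sum>j\<in>parents D i. m j)" if "i \<in> insert v A" for i l
    using that v(2) Suc.prems no_loop[of v] by (intro sum.cong) (auto simp: ancestral_def parents_def)
  have "marginal (insert v A) (m(v := l)) =
      (\<Prod>i\<in>A. \<kappa> i (\<Sum>j\<in>parents D i. m j) (m i)) * \<kappa> v (\<Sum>j\<in>parents D v. m j) l" for l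
  proof -
    have "(\<Prod>i\<in>A. \<kappa> i (\<Sum>j\<in>parents D i. (m(v := l)) j) ((m(v := l)) i)) =
        (\<Prod>i\<in>A. \<kappa> i (\<Sum>j\<in>parents D i. m j) (m i))"
      using v(2) by (intro prod.cong refl arg_cong2[where f = "\<kappa> _"] pa) auto
    then show ?thesis
      unfolding IH using v(2) finite_ancestral[OF Suc.prems] pa[of v l] by simp
  qed
  then have "(\<lambda>l. (\<Prod>i\<in>A. \<kappa> i (\<Sum>j\<in>parents D i. m j) (m i)) * \<kappa> v (\<Sum>j\<in>parents D v. m j) l)
      sums marginal A m"
    using marginal_sums[OF v(2), of m] by simp
  moreover have "(\<lambda>l. (\<Prod>i\<in>A. \<kappa> i (\<Sum>j\<in>parents D i. m j) (m i)) * \<kappa> v (\<Sum>j\<in>parents D v. m j) l)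
      sums ((\<Prod>i\<in>A. \<kappa> i (\<Sum>j\<in>parents D i. m j) (m i)) * 1)"
    using kernel_sums[OF v(1)] by (rule sums_mult)
  ultimately show ?case
    using sums_unique2 by fastforce
qed

text \<open>
  For the set of all non-descendants of \<open>i\<close> this is the previous formula for two ancestral sets that
  differ by \<open>i\<close>. Summing over the value at a vertex outside \<open>S\<close>, which is not a parent of \<open>i\<close>, leaves the
  factor of \<open>i\<close> unchanged and makes \<open>S\<close> smaller.
\<close>

lemma marginal_insert:
  assumes i: "i \<in> V" and S: "parents D i \<subseteq> S" "S \<inter> descendants_refl D i = {}" "S \<subseteq> V"
  shows "marginal (insert i S) m = \<kappa> i (\<Sum>j\<in>parents D i. m j) (m i) * marginal S m"
  using S
proof (induction "card (V - descendants_refl D i - S)" arbitrary: S m)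
  case 0
  let ?A = "V - descendants_refl D i"
  have "?A = S"
    using 0 finite_V by auto
  have "ancestral ?A"
    using parents_subset
    by (auto simp: ancestral_def descendants_refl_def descendants_def parents_def
        dest: trancl_into_trancl)
  moreover have "parents D i \<subseteq> ?A"
    using 0 by auto
  ultimately have "ancestral (insert i ?A)" "ancestral ?A"
    using i by (auto simp: ancestral_def)
  moreover have "i \<notin> ?A"
    by (simp add: descendants_refl_def)
  ultimately show ?case
    using finite_V by (simp add: marginal_ancestral flip: \<open>?A = S\<close>)
next
  case (Suc k)
  have "V - descendants_refl D i - S \<noteq> {}"
    using Suc.hyps(2) by (metis card.empty nat.distinct(1))
  then obtain v where v: "v \<in> V" "v \<notin> descendants_refl D i" "v \<notin> S"
    by blast
  have "V - descendants_refl D i - insert v S = V - descendants_refl D i - S - {v}"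
    by blast
  then have "k = card (V - descendants_refl D i - insert v S)"
    using Suc.hyps(2) v finite_V by simp
  then have IH: "marginal (insert i (insert v S)) m' =
      \<kappa> i (\<Sum>j\<in>parents D i. m' j) (m' i) * marginal (insert v S) m'" for m'
    using Suc.prems v by (intro Suc.hyps(1)) auto
  have "v \<noteq> i"
    using v(2) by (auto simp: descendants_refl_def)
  have pa: "(\<Sum>j\<in>parents D i. (m(v := l)) j) = (\<Sum>j\<in>parents D i. m j)" for l
    using v(3) Suc.prems(1) by (intro sum.cong) auto
  have "marginal (insert v (insert i S)) (m(v := l)) =
      \<kappa> i (\<Sum>j\<in>parents D i. m j) (m i) * marginal (insert v S) (m(v := l))" for l
    using IH[of "m(v := l)"] \<open>v \<noteq> i\<close> unfolding pa by (simp add: insert_commute)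
  moreover have "(\<lambda>l. marginal (insert v (insert i S)) (m(v := l))) sums marginal (insert i S) m"
    using v(3) \<open>v \<noteq> i\<close> by (intro marginal_sums) auto
  moreover have "(\<lambda>l. \<kappa> i (\<Sum>j\<in>parents D i. m j) (m i) * marginal (insert v S) (m(v := l)))
      sums (\<kappa> i (\<Sum>j\<in>parents D i. m j) (m i) * marginal S m)"
    using marginal_sums[OF v(3)] by (rule sums_mult)
  ultimately show ?case
    using sums_unique2 by fastforce
qed

lemma cond_prob_given_parents:
  assumes i: "i \<in> V"
    and pos: "0 < \<P>(\<omega> in M. \<forall>j \<in> parents D i. Poly_Mapping.lookup (N \<omega>) j = Poly_Mapping.lookup n j)"
  shows "\<P>(\<omega> in M. Poly_Mapping.lookup (N \<omega>) i = Poly_Mapping.lookup n i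
      \<bar> \<forall>j \<in> parents D i. Poly_Mapping.lookup (N \<omega>) j = Poly_Mapping.lookup n j) =
    \<kappa> i (weight (parents D i) n) (Poly_Mapping.lookup n i)"
proof -
  have "parents D i \<inter> descendants_refl D i = {}"
    using no_directed_cycle[of i] no_loop[of i]
    by (auto simp: descendants_refl_def descendants_def parents_def dest: trancl_into_trancl)
  then have "marginal (insert i (parents D i)) (Poly_Mapping.lookup n) =
      \<kappa> i (weight (parents D i) n) (Poly_Mapping.lookup n i) * marginal (parents D i) (Poly_Mapping.lookup n)"
    unfolding weight_def by (intro marginal_insert i parents_subset subset_refl)
  then show ?thesis
    using pos by (simp add: cond_prob_def marginal_def)
qed

end


section \<open>The two kernels\<close>

lemma nb_eq_pochhammer: "0 < s \<Longrightarrow> nb s p k = pochhammer s k / fact k * p ^ k * (1 - p) powr s"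
  by (subst pochhammer_Gamma) (auto simp: nb_def elim!: nonpos_Ints_cases)

lemma nb_pos: "0 < s \<Longrightarrow> 0 < p \<Longrightarrow> p < 1 \<Longrightarrow> 0 < nb s p k"
  by (simp add: nb_eq_pochhammer pochhammer_pos)

text \<open>
  This is the binomial series of \<open>(1 - p)\<^bsup>-s\<^esup>\<close>.
\<close>

lemma nb_sums:
  assumes "0 < s" "0 < p" "p < 1"
  shows "nb s p sums 1"
proof -
  have nb_eq: "nb s p = (\<lambda>k. pochhammer s k / fact k * p ^ k * (1 - p) powr s)"
    using assms by (simp add: fun_eq_iff nb_eq_pochhammer)
  have "(\<lambda>k. ((- s) gchoose k) * (- p) ^ k) sums (1 + - p) powr (- s)"
    using assms by (intro gen_binomial_real) auto
  moreover have "((- s) gchoose k) * (- p) ^ k = pochhammer s k / fact k * p ^ k" for k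
  proof -
    have "(-1) ^ k * (- p) ^ k = p ^ k"
      by (simp flip: power_mult_distrib)
    then show ?thesis
      by (simp add: gbinomial_pochhammer)
  qed
  ultimately have "(\<lambda>k. pochhammer s k / fact k * p ^ k * (1 - p) powr s) sums
      ((1 + - p) powr (- s) * (1 - p) powr s)"
    by (intro sums_mult2) simp
  then show ?thesis
    using assms by (simp add: nb_eq powr_minus)
qed

lemma bin_sums:
  assumes "0 < w"
  shows "bin s w sums 1"
proof -
  have "bin s w sums (\<Sum>k\<le>s. bin s w k)"
    by (rule sums_finite) (auto simp: bin_def)
  moreover have "(\<Sum>k\<le>s. bin s w k) = (\<Sum>k\<le>s. real (s choose k) * w ^ k * 1 ^ (s - k)) / (1 + w) ^ s"
    by (simp add: bin_def sum_divide_distrib)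
  moreover have "(\<Sum>k\<le>s. real (s choose k) * w ^ k * 1 ^ (s - k)) = (1 + w) ^ s"
    by (simp only: binomial_ring[symmetric] add.commute)
  ultimately show ?thesis
    using assms by simp
qed

context moral_DAG_graph
begin

lemma nm_probability_eq_prod:
  assumes r: "0 < r" and n: "n \<in> multi_indices V"
    and pos: "\<And>A. A \<subseteq> V \<Longrightarrow> 0 < Delta_sub E A x"
  shows "nm_coeff V E r n * multi_power V x n * Delta V E x powr r =
    (\<Prod>i\<in>V. nb (r + real (weight (parents D i) n)) (u_param E D x i) (Poly_Mapping.lookup n i))"
proof -
  let ?y = "\<lambda>i. - x i"
  let ?q = "ratio ?y" and ?n = "Poly_Mapping.lookup n" and ?s = "\<lambda>i. weight (parents D i) n"
  have posy: "A \<subseteq> V \<Longrightarrow> 0 < delta_sub E A ?y" for A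
    using pos by (simp add: Delta_sub_eq_delta_sub)
  have q: "0 < ?q i" if "i \<in> V" for i
    using posy that by (rule ratio_pos)
  have nz: "delta_sub E (descendants D i) ?y \<noteq> 0" if "i \<in> V" for i
    using posy by (rule delta_sub_descendants_nonzero)
  note u = u_param_eq[of x]
  \<comment> \<open>The monomial identity at \<open>-x\<close>; the signs on both sides cancel below.\<close>
  have "(\<Prod>i\<in>V. (- x i) ^ ?n i) = (\<Prod>i\<in>V. (?q i - 1) ^ ?n i * ?q i ^ ?s i)"
    unfolding weight_def using nz q by (intro monomial_eq_prod_ratio) force+
  moreover have "multi_power V x n = (\<Prod>i\<in>V. (-1) ^ ?n i) * (\<Prod>i\<in>V. (- x i) ^ ?n i)"
    by (simp add: multi_power_def flip: prod.distrib power_mult_distrib)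
  moreover have "(-1) ^ k * ((q - 1) ^ k * c) = (1 - q) ^ k * c" for k and q c :: real
  proof -
    have "(-1) ^ k * (q - 1) ^ k = (1 - q) ^ k"
      by (simp flip: power_mult_distrib)
    then show ?thesis
      by (simp only: mult.assoc[symmetric])
  qed
  ultimately have x: "multi_power V x n = (\<Prod>i\<in>V. (1 - ?q i) ^ ?n i * ?q i ^ ?s i)"
    by (simp only: prod.distrib[symmetric])
  have "Delta V E x = (\<Prod>i\<in>V. ?q i)"
    using delta_V_eq_prod_ratio[of ?y] nz by (simp add: Delta_eq_delta)
  then have "Delta V E x powr r = (\<Prod>i\<in>V. ?q i powr r)"
    using q by (simp add: prod_powr_distrib less_imp_le)
  then have "nm_coeff V E r n * multi_power V x n * Delta V E x powr r =
      (\<Prod>i\<in>V. pochhammer (r + real (?s i)) (?n i) / fact (?n i)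
         * ((1 - ?q i) ^ ?n i * ?q i ^ ?s i) * ?q i powr r)"
    by (simp only: nm_coeff_eq_prod[OF n] x prod.distrib)
  also have "\<dots> = (\<Prod>i\<in>V. nb (r + real (?s i)) (u_param E D x i) (?n i))"
    using r q by (intro prod.cong) (simp_all add: nb_eq_pochhammer u powr_add powr_realpow)
  finally show ?thesis .
qed

text \<open>
  This holds for unbounded \<open>n\<close> as well, both sides then being zero. So the factorization can be applied
  to the whole law.
\<close>

lemma mult_probability_eq_prod:
  assumes n: "n \<in> multi_indices V" and y: "\<And>i. i \<in> V \<Longrightarrow> 0 < y i"
  shows "mult_coeff V E r n * multi_power V y n / delta V E y ^ r =
    (\<Prod>i\<in>V. bin (r - weight (parents D i) n) (w_param E D y i) (Poly_Mapping.lookup n i))"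
proof (cases "mult_coeff V E r n = 0")
  case True
  then obtain i where "i \<in> V" "(r - weight (parents D i) n) choose Poly_Mapping.lookup n i = 0"
    using finite_V by (auto simp: mult_coeff_eq_prod[OF n])
  then have "(\<Prod>i\<in>V. bin (r - weight (parents D i) n) (w_param E D y i) (Poly_Mapping.lookup n i)) = 0"
    using finite_V by (intro prod_zero) (auto simp: bin_def)
  then show ?thesis
    using True by simp
next
  case False
  let ?q = "ratio y" and ?n = "Poly_Mapping.lookup n" and ?s = "\<lambda>i. weight (parents D i) n"
  have s: "?s i \<le> r" for i
    using mult_coeff_nonzero_imp_bounded[OF n False] clique_parents by (intro weight_clique_le[OF finite_V])
  have pos: "A \<subseteq> V \<Longrightarrow> 0 < delta_sub E A y" for A
    using y finite_V by (intro delta_sub_pos) (auto intro: finite_subset)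
  have q: "0 < ?q i" if "i \<in> V" for i
    using pos that by (rule ratio_pos)
  have nz: "delta_sub E (descendants D i) y \<noteq> 0" if "i \<in> V" for i
    using pos by (rule delta_sub_descendants_nonzero)
  note w = w_param_eq[of y]
  have m: "multi_power V y n = (\<Prod>i\<in>V. (?q i - 1) ^ ?n i * ?q i ^ ?s i)"
    unfolding weight_def multi_power_def using nz q by (intro monomial_eq_prod_ratio) force+
  have "delta V E y ^ r = (\<Prod>i\<in>V. ?q i ^ r)"
    using delta_V_eq_prod_ratio[of y] nz by (simp add: prod_power_distrib)
  then have "mult_coeff V E r n * multi_power V y n / delta V E y ^ r =
      (\<Prod>i\<in>V. real ((r - ?s i) choose ?n i) * ((?q i - 1) ^ ?n i * ?q i ^ ?s i) / ?q i ^ r)"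
    by (simp only: mult_coeff_eq_prod[OF n] m prod.distrib prod_dividef)
  also have "\<dots> = (\<Prod>i\<in>V. bin (r - ?s i) (w_param E D y i) (?n i))"
  proof (rule prod.cong[OF refl])
    fix i assume "i \<in> V"
    have "?q i ^ r = ?q i ^ (r - ?s i) * ?q i ^ ?s i"
      using s[of i] by (simp flip: power_add)
    then show "real ((r - ?s i) choose ?n i) * ((?q i - 1) ^ ?n i * ?q i ^ ?s i) / ?q i ^ r =
        bin (r - ?s i) (w_param E D y i) (?n i)"
      using q[OF \<open>i \<in> V\<close>] by (simp add: bin_def w)
  qed
  finally show ?thesis .
qed

lemma finite_bounded_multi_indices: "finite (bounded_multi_indices V E r)"
proof -
  have "bounded_multi_indices V E r \<subseteq>
      (\<lambda>f. \<Sum>i\<in>V. Poly_Mapping.single i (f i)) ` PiE V (\<lambda>_. {..r})"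
  proof
    fix n assume n: "n \<in> bounded_multi_indices V E r"
    have "Poly_Mapping.lookup n i \<le> r" if "i \<in> V" for i
      using weight_clique_le[OF finite_V n, of "{i}"] that
      by (simp add: weight_def cliques_def clique_def)
    moreover have "n = (\<Sum>i\<in>V. Poly_Mapping.single i (restrict (Poly_Mapping.lookup n) V i))"
      using n finite_V
      by (auto simp: poly_mapping_eq_iff fun_eq_iff lookup_sum lookup_single when_def
          bounded_multi_indices_def multi_indices_def in_keys_iff)
    ultimately show "n \<in> (\<lambda>f. \<Sum>i\<in>V. Poly_Mapping.single i (f i)) ` PiE V (\<lambda>_. {..r})"
      by (intro image_eqI[of _ _ "restrict (Poly_Mapping.lookup n) V"]) auto
  qed
  then show ?thesis
    by (rule finite_subset) (simp add: finite_V finite_PiE)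
qed

lemma delta_power_eq_sum_mult_coeff:
  "delta V E y ^ r = (\<Sum>n\<in>bounded_multi_indices V E r. mult_coeff V E r n * multi_power V y n)"
proof -
  let ?C = "multicolourings E V r" and ?B = "bounded_multi_indices V E r"
  let ?e = "\<lambda>c::'v \<Rightarrow> nat set. \<Sum>i\<in>V. Poly_Mapping.single i (card (c i))"
  have e: "Poly_Mapping.lookup (?e c) i = (if i \<in> V then card (c i) else 0)" for c i
    using finite_V by (simp add: lookup_sum lookup_single when_def)
  have eV: "?e c \<in> multi_indices V" for c
    by (auto simp: multi_indices_def in_keys_iff e split: if_splits)
  have e_eq: "?e c = n \<longleftrightarrow> (\<forall>i\<in>V. card (c i) = Poly_Mapping.lookup n i)"
    if "n \<in> multi_indices V" for c n
    using that by (auto simp: poly_mapping_eq_iff fun_eq_iff e multi_indices_def in_keys_iff)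
  have fin: "finite ?C"
    using finite_V by (rule finite_multicolourings)
  have "?e ` ?C \<subseteq> ?B"
  proof safe
    fix c assume c: "c \<in> ?C"
    have "c \<in> {c' \<in> ?C. \<forall>i\<in>V. card (c' i) = Poly_Mapping.lookup (?e c) i}"
      using c by (simp add: e)
    then have "mult_coeff V E r (?e c) \<noteq> 0"
      unfolding mult_coeff_eq_colouring_count[OF finite_V eV] colouring_count_def
      using fin by (auto simp: card_eq_0_iff)
    then show "?e c \<in> ?B"
      using eV by (intro mult_coeff_nonzero_imp_bounded)
  qed
  have "delta V E y ^ r = (\<Sum>c\<in>?C. multi_power V y (?e c))"
    by (simp add: delta_power_eq_sum_multicolourings[OF finite_V] multi_power_def e)
  also have "\<dots> = (\<Sum>n\<in>?B. \<Sum>c\<in>{c \<in> ?C. ?e c = n}. multi_power V y (?e c))"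
    using \<open>?e ` ?C \<subseteq> ?B\<close> fin finite_bounded_multi_indices by (intro sum.group[symmetric]) auto
  also have "\<dots> = (\<Sum>n\<in>?B. mult_coeff V E r n * multi_power V y n)"
  proof (rule sum.cong[OF refl])
    fix n assume "n \<in> ?B"
    then have n: "n \<in> multi_indices V"
      by (simp add: bounded_multi_indices_def)
    show "(\<Sum>c\<in>{c \<in> ?C. ?e c = n}. multi_power V y (?e c)) = mult_coeff V E r n * multi_power V y n"
      by (simp add: mult_coeff_eq_colouring_count[OF finite_V n] colouring_count_def e_eq[OF n, symmetric])
  qed
  finally show ?thesis .
qed

text \<open>
  The prescribed weights add up to \<open>\<delta>\<^sup>r / \<delta>\<^sup>r\<close>, because all multi-indices with a nonzero coefficient are
  bounded.
\<close>

lemma prob_bounded_multi_indices: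
  assumes M: "prob_space M" and N: "mult_distributed M N V E r y" and y: "\<And>i. i \<in> V \<Longrightarrow> 0 < y i"
  shows "\<P>(\<omega> in M. N \<omega> \<in> bounded_multi_indices V E r) = 1"
proof -
  interpret prob_space M by (rule M)
  let ?B = "bounded_multi_indices V E r"
  have meas: "{\<omega> \<in> space M. N \<omega> = n} \<in> sets M" for n
    using N count_space_event[of N M "multi_indices V" "\<lambda>m. m = n"] by (simp add: mult_distributed_def)
  have "0 < delta V E y"
    using delta_sub_pos[OF finite_V y] by (simp add: delta_sub_eq_delta)
  have "{\<omega> \<in> space M. N \<omega> \<in> ?B} = (\<Union>n\<in>?B. {\<omega> \<in> space M. N \<omega> = n})"
    by auto
  then have "\<P>(\<omega> in M. N \<omega> \<in> ?B) = (\<Sum>n\<in>?B. \<P>(\<omega> in M. N \<omega> = n))"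
    using meas finite_bounded_multi_indices
    by (simp only:) (intro finite_measure_finite_Union; auto simp: disjoint_family_on_def)
  also have "\<dots> = (\<Sum>n\<in>?B. mult_coeff V E r n * multi_power V y n / delta V E y ^ r)"
    using N by (intro sum.cong) (auto simp: mult_distributed_def)
  also have "\<dots> = 1"
    using \<open>0 < delta V E y\<close>
    by (simp add: delta_power_eq_sum_mult_coeff[symmetric] flip: sum_divide_distrib)
  finally show ?thesis .
qed

lemma nm_factorization:
  assumes M: "prob_space M" and r: "0 < r" and x: "x \<in> M_set V E" and N: "nm_distributed M N V E r x"
  shows "\<forall>i\<in>V. 0 < u_param E D x i \<and> u_param E D x i < 1"
    and "n \<in> multi_indices V \<Longrightarrow> \<P>(\<omega> in M. N \<omega> = n) =
      (\<Prod>i\<in>V. nb (r + real (weight (parents D i) n)) (u_param E D x i) (Poly_Mapping.lookup n i))"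
    and "n \<in> multi_indices V \<Longrightarrow> i \<in> V \<Longrightarrow>
      \<P>(\<omega> in M. Poly_Mapping.lookup (N \<omega>) i = Poly_Mapping.lookup n i
          \<bar> \<forall>j \<in> parents D i. Poly_Mapping.lookup (N \<omega>) j = Poly_Mapping.lookup n j) =
        nb (r + real (weight (parents D i) n)) (u_param E D x i) (Poly_Mapping.lookup n i)"
proof -
  let ?y = "\<lambda>i. - x i"
  have xpos: "0 < x i" if "i \<in> V" for i
    using x that by (simp add: M_set_def)
  have pos: "0 < Delta_sub E A x" if "A \<subseteq> V" for A
    using x that by (simp add: M_set_def)
  then have posy: "A \<subseteq> V \<Longrightarrow> 0 < delta_sub E A ?y" for A
    by (simp add: Delta_sub_eq_delta_sub)
  have q: "0 < ratio ?y i" if "i \<in> V" for i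
    using posy that by (rule ratio_pos)
  have nz: "delta_sub E (descendants D i) ?y \<noteq> 0" if "i \<in> V" for i
    using posy by (rule delta_sub_descendants_nonzero)
  note u = u_param_eq[of x]
  have u01: "0 < u_param E D x i \<and> u_param E D x i < 1" if i: "i \<in> V" for i
  proof
    have "0 < (\<Prod>j\<in>children i. ratio ?y j)"
      using q arc_in_V by (intro prod_pos) (auto simp: children_def)
    moreover have "u_param E D x i * (\<Prod>j\<in>children i. ratio ?y j) = x i"
      using ratio_minus_1[OF i, of ?y] nz q by (force simp: u algebra_simps)
    ultimately show "0 < u_param E D x i"
      using xpos[OF i] by (metis zero_less_mult_pos2)
    show "u_param E D x i < 1"
      using q[OF i] by (simp add: u)
  qed
  then show "\<forall>i\<in>V. 0 < u_param E D x i \<and> u_param E D x i < 1"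
    by blast
  let ?\<kappa> = "\<lambda>i s. nb (r + real s) (u_param E D x i)"
  have prob: "\<P>(\<omega> in M. N \<omega> = n) =
      (\<Prod>i\<in>V. ?\<kappa> i (weight (parents D i) n) (Poly_Mapping.lookup n i))"
    if "n \<in> multi_indices V" for n
    using N that nm_probability_eq_prod[OF r that pos] by (simp add: nm_distributed_def)
  then show "n \<in> multi_indices V \<Longrightarrow> \<P>(\<omega> in M. N \<omega> = n) =
      (\<Prod>i\<in>V. ?\<kappa> i (weight (parents D i) n) (Poly_Mapping.lookup n i))" .
  interpret prob_space M by (rule M)
  interpret DAG_factorization V E D M N ?\<kappa>
    using N u01 r prob by unfold_locales (auto simp: nm_distributed_def intro!: nb_sums)
  assume n: "n \<in> multi_indices V" and i: "i \<in> V"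
  have "0 < \<P>(\<omega> in M. N \<omega> = n)"
    using u01 r by (auto simp: prob[OF n] intro!: prod_pos nb_pos)
  also have "\<dots> \<le> \<P>(\<omega> in M. \<forall>j \<in> parents D i. Poly_Mapping.lookup (N \<omega>) j = Poly_Mapping.lookup n j)"
    using N_event[of "\<lambda>m. \<forall>j \<in> parents D i. Poly_Mapping.lookup m j = Poly_Mapping.lookup n j"]
    by (intro finite_measure_mono) auto
  finally show "\<P>(\<omega> in M. Poly_Mapping.lookup (N \<omega>) i = Poly_Mapping.lookup n i
          \<bar> \<forall>j \<in> parents D i. Poly_Mapping.lookup (N \<omega>) j = Poly_Mapping.lookup n j) =
        ?\<kappa> i (weight (parents D i) n) (Poly_Mapping.lookup n i)"
    by (rule cond_prob_given_parents[OF i])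
qed

lemma mult_factorization:
  assumes M: "prob_space M" and ypos: "\<forall>i\<in>V. 0 < y i" and N: "mult_distributed M N V E r y"
  shows "\<forall>i\<in>V. 0 < w_param E D y i"
    and "n \<in> bounded_multi_indices V E r \<Longrightarrow> i \<in> V \<Longrightarrow>
      weight (parents D i) n + Poly_Mapping.lookup n i \<le> r"
    and "n \<in> bounded_multi_indices V E r \<Longrightarrow> \<P>(\<omega> in M. N \<omega> = n) =
      (\<Prod>i\<in>V. bin (r - weight (parents D i) n) (w_param E D y i) (Poly_Mapping.lookup n i))"
    and "i \<in> V \<Longrightarrow>
      0 < \<P>(\<omega> in M. \<forall>j \<in> parents D i. Poly_Mapping.lookup (N \<omega>) j = Poly_Mapping.lookup n j) \<Longrightarrow>
      weight (parents D i) n \<le> r \<and>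
      \<P>(\<omega> in M. Poly_Mapping.lookup (N \<omega>) i = Poly_Mapping.lookup n i
          \<bar> \<forall>j \<in> parents D i. Poly_Mapping.lookup (N \<omega>) j = Poly_Mapping.lookup n j) =
        bin (r - weight (parents D i) n) (w_param E D y i) (Poly_Mapping.lookup n i)"
proof -
  have y: "0 < y i" if "i \<in> V" for i
    using ypos that by blast
  have pos: "A \<subseteq> V \<Longrightarrow> 0 < delta_sub E A y" for A
    using y finite_V by (intro delta_sub_pos) (auto intro: finite_subset)
  have q: "0 < ratio y i" if "i \<in> V" for i
    using pos that by (rule ratio_pos)
  have nz: "delta_sub E (descendants D i) y \<noteq> 0" if "i \<in> V" for i
    using pos by (rule delta_sub_descendants_nonzero)
  note w = w_param_eq[of y]
  have w0: "0 < w_param E D y i" if i: "i \<in> V" for i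
  proof -
    have "0 < (\<Prod>j\<in>children i. ratio y j)"
      using q arc_in_V by (intro prod_pos) (auto simp: children_def)
    moreover have "w_param E D y i * (\<Prod>j\<in>children i. ratio y j) = y i"
      using ratio_minus_1[OF i, of y] nz q by (force simp: w)
    ultimately show ?thesis
      using y[OF i] by (metis zero_less_mult_pos2)
  qed
  then show "\<forall>i\<in>V. 0 < w_param E D y i"
    by blast
  show "weight (parents D i) n + Poly_Mapping.lookup n i \<le> r"
    if "n \<in> bounded_multi_indices V E r" "i \<in> V" for n i
  proof -
    have "weight (insert i (parents D i)) n \<le> r"
      using that clique_insert_parents by (intro weight_clique_le[OF finite_V]) auto
    moreover have "i \<notin> parents D i"
      using no_loop by (simp add: parents_def)
    ultimately show ?thesis
      using finite_parents by (simp add: weight_def add.commute)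
  qed
  interpret prob_space M by (rule M)
  let ?B = "bounded_multi_indices V E r"
  let ?\<kappa> = "\<lambda>i s. bin (r - s) (w_param E D y i)"
  have meas: "{\<omega> \<in> space M. Q (N \<omega>)} \<in> sets M" for Q
    using N by (intro count_space_event) (auto simp: mult_distributed_def)
  have prob: "\<P>(\<omega> in M. N \<omega> = n) =
      (\<Prod>i\<in>V. ?\<kappa> i (weight (parents D i) n) (Poly_Mapping.lookup n i))"
    if n: "n \<in> multi_indices V" for n
  proof (cases "n \<in> ?B")
    case True
    then show ?thesis
      using N mult_probability_eq_prod[OF n, where y = y and r = r] y by (simp add: mult_distributed_def)
  next
    case False
    have "\<P>(\<omega> in M. N \<omega> = n) \<le> \<P>(\<omega> in M. \<not> N \<omega> \<in> ?B)"
      using False meas[of "\<lambda>m. m \<notin> ?B"] by (intro finite_measure_mono) auto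
    also have "\<dots> = 0"
      using prob_bounded_multi_indices[OF M N y] prob_neg[OF meas[of "\<lambda>m. m \<in> ?B"]] by simp
    finally have "\<P>(\<omega> in M. N \<omega> = n) = 0"
      by (simp add: measure_le_0_iff)
    moreover have "mult_coeff V E r n = 0"
      using False mult_coeff_nonzero_imp_bounded[OF n] by blast
    ultimately show ?thesis
      using mult_probability_eq_prod[OF n, where y = y and r = r] y by simp
  qed
  then show "n \<in> ?B \<Longrightarrow> \<P>(\<omega> in M. N \<omega> = n) =
      (\<Prod>i\<in>V. ?\<kappa> i (weight (parents D i) n) (Poly_Mapping.lookup n i))"
    by (simp add: bounded_multi_indices_def)
  interpret DAG_factorization V E D M N ?\<kappa>
    using N w0 prob by unfold_locales (auto simp: mult_distributed_def intro!: bin_sums)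
  let ?P = "\<lambda>\<omega>. \<forall>j \<in> parents D i. Poly_Mapping.lookup (N \<omega>) j = Poly_Mapping.lookup n j"
  assume i: "i \<in> V" and posP: "0 < \<P>(\<omega> in M. ?P \<omega>)"
  \<comment> \<open>A conditioning event of positive probability contains an outcome with a bounded value of \<open>N\<close>,
    and boundedness controls the clique of the parents.\<close>
  have "\<exists>\<omega>\<in>space M. ?P \<omega> \<and> N \<omega> \<in> ?B"
  proof (rule ccontr)
    assume "\<not> ?thesis"
    then have "{\<omega> \<in> space M. ?P \<omega>} \<subseteq> {\<omega> \<in> space M. \<not> N \<omega> \<in> ?B}"
      by blast
    then have "\<P>(\<omega> in M. ?P \<omega>) \<le> \<P>(\<omega> in M. \<not> N \<omega> \<in> ?B)"
      using N_event[of "\<lambda>m. m \<notin> ?B"] by (intro finite_measure_mono)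
    also have "\<dots> = 0"
      using prob_bounded_multi_indices[OF M N y] prob_neg[OF meas[of "\<lambda>m. m \<in> ?B"]] by simp
    finally show False
      using posP by simp
  qed
  then obtain \<omega> where "?P \<omega>" "N \<omega> \<in> ?B"
    by blast
  then have "weight (parents D i) n \<le> r"
    using weight_clique_le[OF finite_V \<open>N \<omega> \<in> ?B\<close> clique_parents, of i]
    by (simp add: weight_def)
  then show "weight (parents D i) n \<le> r \<and>
      \<P>(\<omega> in M. Poly_Mapping.lookup (N \<omega>) i = Poly_Mapping.lookup n i \<bar> ?P \<omega>) =
        ?\<kappa> i (weight (parents D i) n) (Poly_Mapping.lookup n i)"
    using cond_prob_given_parents[OF i posP] by simp
qed

end

theorem theorem3p11:
  fixes V :: "'v set" and E :: "'v set set" and D :: "('v \<times> 'v) set"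
  assumes "finite_simple_graph V E"
    and "moral_DAG V E D"
  shows
    "(\<forall>(M :: 'a measure) (N :: 'a \<Rightarrow> 'v \<Rightarrow>\<^sub>0 nat) (r :: real) (x :: 'v \<Rightarrow> real).
        prob_space M \<and> r > 0 \<and> x \<in> M_set V E \<and> nm_distributed M N V E r x \<longrightarrow>
          (\<forall>i\<in>V. 0 < u_param E D x i \<and> u_param E D x i < 1) \<and>
          (\<forall>n \<in> multi_indices V.
             \<P>(\<omega> in M. N \<omega> = n) =
               (\<Prod>i\<in>V. nb (r + real (weight (parents D i) n)) (u_param E D x i) (Poly_Mapping.lookup n i))) \<and>
          (\<forall>n \<in> multi_indices V. \<forall>i\<in>V.
             \<P>(\<omega> in M. Poly_Mapping.lookup (N \<omega>) i = Poly_Mapping.lookup n i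
                 \<bar> \<forall>j \<in> parents D i. Poly_Mapping.lookup (N \<omega>) j = Poly_Mapping.lookup n j) =
               nb (r + real (weight (parents D i) n)) (u_param E D x i) (Poly_Mapping.lookup n i)))
     \<and>
     (\<forall>(M :: 'b measure) (N :: 'b \<Rightarrow> 'v \<Rightarrow>\<^sub>0 nat) (r :: nat) (y :: 'v \<Rightarrow> real).
        prob_space M \<and> r \<ge> 1 \<and> (\<forall>i\<in>V. 0 < y i) \<and> mult_distributed M N V E r y \<longrightarrow>
          (\<forall>i\<in>V. 0 < w_param E D y i) \<and>
          (\<forall>n \<in> bounded_multi_indices V E r.
             (\<forall>i\<in>V. weight (parents D i) n + Poly_Mapping.lookup n i \<le> r) \<and>
             \<P>(\<omega> in M. N \<omega> = n) =
               (\<Prod>i\<in>V. bin (r - weight (parents D i) n) (w_param E D y i) (Poly_Mapping.lookup n i))) \<and>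
          (\<forall>n \<in> multi_indices V. \<forall>i\<in>V.
             \<P>(\<omega> in M. \<forall>j \<in> parents D i. Poly_Mapping.lookup (N \<omega>) j = Poly_Mapping.lookup n j) > 0 \<longrightarrow>
               weight (parents D i) n \<le> r \<and>
               \<P>(\<omega> in M. Poly_Mapping.lookup (N \<omega>) i = Poly_Mapping.lookup n i
                   \<bar> \<forall>j \<in> parents D i. Poly_Mapping.lookup (N \<omega>) j = Poly_Mapping.lookup n j) =
                 bin (r - weight (parents D i) n) (w_param E D y i) (Poly_Mapping.lookup n i)))"
proof -
  interpret moral_DAG_graph V E D
    using assms by unfold_locales
  show ?thesis
  proof ((rule conjI; intro allI impI; elim conjE), goal_cases)
    case (1 M N r x)
    note h = nm_factorization[OF 1]
    show ?case
      by (intro conjI ballI h(2,3)) (use h(1) in \<open>simp_all only: Ball_def\<close>)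
  next
    case (2 M N r y)
    note h = mult_factorization[OF 2(1) 2(3) 2(4)]
    show ?case
      by (rule conjI[OF h(1)], rule conjI)
        (((intro ballI conjI h(2,3)); assumption), ((intro ballI impI, rule h(4)); assumption))
  qed
qed

end
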